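(* Let $b\ge2$ be an integer, $\theta\in(0,1)$ irrational, $\rho\in[0,1)$, and let $\xi$ be $\xi_b(\theta,\rho)$ or $\xi'_b(\theta,\rho)$, with attached digit sequence $(b_k)_{k\ge1}$ and quantities $t_k,r_k$ as in the context. For $k\ge0$ define $$\nu_k(1)=2+\frac{t_k}{r_{k+1}},\quad \nu_k(2)=2+\frac{r_k}{r_{k+1}+t_k},\quad \nu_k(3)=1+\frac{q_{k+1}}{r_{k+1}+q_k},\quad \nu_k(4)=1+\frac{r_{k+2}}{q_{k+1}},$$ and $$\nu(1)=\limsup_{k\to\infty}\{\nu_k(1): a_{k+1}-b_{k+1}\ge1\text{ and }a_{k+2}-b_{k+2}\ge1\},\quad \nu(2)=\limsup_{k\to\infty}\{\nu_k(2): a_{k+2}-b_{k+2}\ge1\},$$ $\nu(3)=\limsup_{k\to\infty}\nu_k(3)$, $\nu(4)=\limsup_{k\to\infty}\nu_k(4)$. Then the irrationality exponent of $\xi$ equals $\max\{\nu(1),\nu(2),\nu(3),\nu(4)\}$.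
   Context: Let $\theta=[0;a_1,a_2,\dots]$ with convergents $p_k/q_k$ ($q_{-1}=0,q_0=1,p_{-1}=1,p_0=0$, $q_k=a_kq_{k-1}+q_{k-2}$), and $\theta_k=q_k\theta-p_k$. For $n\ge1$, $s_n=\lfloor n\theta+\rho\rfloor-\lfloor(n-1)\theta+\rho\rfloor$, $s'_n=\lceil n\theta+\rho\rceil-\lceil(n-1)\theta+\rho\rceil$, and $\xi_b(\theta,\rho)=(b-1)\sum_{n\ge1}s_n b^{-n}$, $\xi'_b(\theta,\rho)=(b-1)\sum_{n\ge1}s'_nb^{-n}$. Ostrowski expansion of reals: every $\sigma\in[-\theta,1-\theta]$ not in $\mathbb{Z}\theta+\mathbb{Z}$, or in $\mathbb{Z}_{\ge0}\theta+\mathbb{Z}$, is uniquely $\sigma=\sum_{k\ge1}\beta_k\theta_{k-1}$ with integers $0\le\beta_1\le a_1-1$, $0\le \beta_k\le a_k$, $\beta_k=0$ whenever $\beta_{k+1}=a_{k+1}$, and infinitely many odd and infinitely many even $k$ with $\beta_k<a_k$. Ostrowski expansion of an integer $N\ge0$: $N=\sum_{j\ge1}d_jq_{j-1}$ with $0\le d_1\le a_1-1$, $0\le d_j\le a_j$, $d_j=0$ whenever $d_{j+1}=a_{j+1}$. Digit sequence $(b_k)_{k\ge1}$ attached to $\xi$: (A) If $\rho\notin\mathbb{Z}\theta+\mathbb{Z}$ or $\rho\in\mathbb{Z}_{\ge1}\theta+\mathbb{Z}$, $(b_k)$ is the sequence of Ostrowski digits of $\rho-\theta$. (B) Otherwise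 $\rho-\theta=-m\theta+p$ with integers $m\ge1$, $p$. If $m=1$, put $l=0$, $\beta=(a_1-1,0,a_3,0,a_5,0,\dots)$, $\beta'=(0,a_2,0,a_4,0,\dots)$. If $m\ge2$, let $l\ge0$ with $q_l<m\le q_{l+1}$, let $q_{l+1}-m=\beta_1q_0+\cdots+\beta_{l+1}q_l$ be the Ostrowski expansion of $q_{l+1}-m$, and set $\beta_{l+2j}=0$, $\beta_{l+2j+1}=a_{l+2j+1}$ ($j\ge1$); $\beta'_i=\beta_i$ ($i\le l$), $\beta'_{l+1}=\beta_{l+1}+1$, $\beta'_{l+2}=a_{l+2}-1$, $\beta'_{l+2j+1}=0$, $\beta'_{l+2j+2}=a_{l+2j+2}$ ($j\ge1$). For $\xi=\xi_b(\theta,\rho)$ take $(b_k)=\beta$ if $l$ odd, $\beta'$ if $l$ even; for $\xi=\xi'_b(\theta,\rho)$ take $\beta'$ if $l$ odd, $\beta$ if $l$ even. Put $t_0=0$, $r_0=1$, and for $k\ge1$, $t_k=\sum_{j=1}^k b_jq_{j-1}$, $r_k=q_k-t_k$. The irrationality exponent $\mu(\zeta)$ of an irrational $\zeta$ is the supremum of the real $\mu$ such that $|\zeta-p/q|<q^{-\mu}$ has infinitely many rational solutions $p/q$. *)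

theory Defs
  imports Complex_Main "HOL-Library.Extended_Real"
begin

text \<open>Continued fraction of an irrational \<open>\<theta> \<in> (0,1)\<close>: complete quotients come from iterating
  the Gauss map. Only \<open>cf_a \<theta> k\<close> with \<open>k \<ge> 1\<close> is a partial quotient after the integer part
  \<open>cf_a \<theta> 0 = 0\<close>.\<close>

primrec gauss_iter :: "real \<Rightarrow> nat \<Rightarrow> real" where
  "gauss_iter \<theta> 0 = \<theta>"
| "gauss_iter \<theta> (Suc n) = frac (1 / gauss_iter \<theta> n)"

primrec cf_a :: "real \<Rightarrow> nat \<Rightarrow> int" where
  "cf_a \<theta> 0 = 0"
| "cf_a \<theta> (Suc n) = \<lfloor>1 / gauss_iter \<theta> n\<rfloor>"

text \<open>The values at index \<open>-1\<close> (\<open>q = 0\<close>, \<open>p = 1\<close>) are built into the equations for index \<open>1\<close>.\<close>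

fun cf_q :: "real \<Rightarrow> nat \<Rightarrow> int" where
  "cf_q \<theta> 0 = 1"
| "cf_q \<theta> (Suc 0) = cf_a \<theta> (Suc 0) * 1 + 0"
| "cf_q \<theta> (Suc (Suc k)) = cf_a \<theta> (Suc (Suc k)) * cf_q \<theta> (Suc k) + cf_q \<theta> k"

fun cf_p :: "real \<Rightarrow> nat \<Rightarrow> int" where
  "cf_p \<theta> 0 = 0"
| "cf_p \<theta> (Suc 0) = cf_a \<theta> (Suc 0) * 0 + 1"
| "cf_p \<theta> (Suc (Suc k)) = cf_a \<theta> (Suc (Suc k)) * cf_p \<theta> (Suc k) + cf_p \<theta> k"

definition cf_theta :: "real \<Rightarrow> nat \<Rightarrow> real" where
  "cf_theta \<theta> k = of_int (cf_q \<theta> k) * \<theta> - of_int (cf_p \<theta> k)"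

definition sturm_lower :: "real \<Rightarrow> real \<Rightarrow> nat \<Rightarrow> int" where
  "sturm_lower \<theta> \<rho> n = \<lfloor>real n * \<theta> + \<rho>\<rfloor> - \<lfloor>(real n - 1) * \<theta> + \<rho>\<rfloor>"

definition sturm_upper :: "real \<Rightarrow> real \<Rightarrow> nat \<Rightarrow> int" where
  "sturm_upper \<theta> \<rho> n = \<lceil>real n * \<theta> + \<rho>\<rceil> - \<lceil>(real n - 1) * \<theta> + \<rho>\<rceil>"

definition xi_lower :: "int \<Rightarrow> real \<Rightarrow> real \<Rightarrow> real" where
  "xi_lower b \<theta> \<rho> =
     (of_int b - 1) * (\<Sum>n. of_int (sturm_lower \<theta> \<rho> (Suc n)) / of_int b ^ Suc n)"

definition xi_upper :: "int \<Rightarrow> real \<Rightarrow> real \<Rightarrow> real" where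
  "xi_upper b \<theta> \<rho> =
     (of_int b - 1) * (\<Sum>n. of_int (sturm_upper \<theta> \<rho> (Suc n)) / of_int b ^ Suc n)"

text \<open>Digit sequences are indexed from \<open>1\<close>; their value at \<open>0\<close> is irrelevant throughout.\<close>

definition ostrowski_real :: "real \<Rightarrow> real \<Rightarrow> (nat \<Rightarrow> int) \<Rightarrow> bool" where
  "ostrowski_real \<theta> \<sigma> d \<longleftrightarrow>
     (\<lambda>k. of_int (d (Suc k)) * cf_theta \<theta> k) sums \<sigma> \<and>
     d 1 \<le> cf_a \<theta> 1 - 1 \<and>
     (\<forall>k\<ge>1. 0 \<le> d k \<and> d k \<le> cf_a \<theta> k) \<and>
     (\<forall>k\<ge>1. d (k + 1) = cf_a \<theta> (k + 1) \<longrightarrow> d k = 0) \<and>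
     infinite {k. k \<ge> 1 \<and> odd k \<and> d k < cf_a \<theta> k} \<and>
     infinite {k. k \<ge> 1 \<and> even k \<and> d k < cf_a \<theta> k}"

text \<open>\<open>d 1, \<dots>, d n\<close> are the Ostrowski digits of the integer \<open>N\<close>, all further digits being \<open>0\<close>;
  \<open>d\<close> itself is not constrained beyond \<open>n\<close>.\<close>

definition ostrowski_int :: "real \<Rightarrow> nat \<Rightarrow> int \<Rightarrow> (nat \<Rightarrow> int) \<Rightarrow> bool" where
  "ostrowski_int \<theta> n N d \<longleftrightarrow>
     N = (\<Sum>j=1..n. d j * cf_q \<theta> (j - 1)) \<and>
     (n \<ge> 1 \<longrightarrow> d 1 \<le> cf_a \<theta> 1 - 1) \<and>
     (\<forall>j\<in>{1..n}. 0 \<le> d j \<and> d j \<le> cf_a \<theta> j) \<and>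
     (\<forall>j\<in>{1..<n}. d (j + 1) = cf_a \<theta> (j + 1) \<longrightarrow> d j = 0)"

text \<open>The two digit sequences \<open>\<beta>\<close>, \<open>\<beta>'\<close> and the index \<open>l\<close> belonging to \<open>-m\<theta> + p\<close>, \<open>m \<ge> 1\<close>.\<close>

definition neg_digits ::
  "real \<Rightarrow> int \<Rightarrow> nat \<Rightarrow> (nat \<Rightarrow> int) \<Rightarrow> (nat \<Rightarrow> int) \<Rightarrow> bool" where
  "neg_digits \<theta> m l \<beta> \<beta>' \<longleftrightarrow>
     (m = 1 \<and> l = 0 \<and>
       \<beta> 1 = cf_a \<theta> 1 - 1 \<and>
       (\<forall>j\<ge>1. \<beta> (2 * j) = 0 \<and> \<beta> (2 * j + 1) = cf_a \<theta> (2 * j + 1)) \<and>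
       \<beta>' 1 = 0 \<and>
       (\<forall>j\<ge>1. \<beta>' (2 * j) = cf_a \<theta> (2 * j) \<and> \<beta>' (2 * j + 1) = 0)) \<or>
     (m \<ge> 2 \<and> cf_q \<theta> l < m \<and> m \<le> cf_q \<theta> (l + 1) \<and>
       ostrowski_int \<theta> (l + 1) (cf_q \<theta> (l + 1) - m) \<beta> \<and>
       (\<forall>j\<ge>1. \<beta> (l + 2 * j) = 0 \<and> \<beta> (l + 2 * j + 1) = cf_a \<theta> (l + 2 * j + 1)) \<and>
       (\<forall>i\<in>{1..l}. \<beta>' i = \<beta> i) \<and>
       \<beta>' (l + 1) = \<beta> (l + 1) + 1 \<and>
       \<beta>' (l + 2) = cf_a \<theta> (l + 2) - 1 \<and>
       (\<forall>j\<ge>1. \<beta>' (l + 2 * j + 1) = 0 \<and> \<beta>' (l + 2 * j + 2) = cf_a \<theta> (l + 2 * j + 2)))"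

text \<open>\<open>upper\<close> distinguishes the ceiling version \<open>xi_upper\<close> from the floor version \<open>xi_lower\<close>.\<close>

definition attached_digits :: "bool \<Rightarrow> real \<Rightarrow> real \<Rightarrow> (nat \<Rightarrow> int) \<Rightarrow> bool" where
  "attached_digits upper \<theta> \<rho> d \<longleftrightarrow>
     (if (\<nexists>i j :: int. \<rho> = of_int i * \<theta> + of_int j) \<or>
         (\<exists>i j :: int. i \<ge> 1 \<and> \<rho> = of_int i * \<theta> + of_int j)
      then ostrowski_real \<theta> (\<rho> - \<theta>) d
      else \<exists>(m :: int) (p :: int) l \<beta> \<beta>'.
             m \<ge> 1 \<and> \<rho> - \<theta> = - of_int m * \<theta> + of_int p \<and>
             neg_digits \<theta> m l \<beta> \<beta>' \<and>
             d = (if upper then (if odd l then \<beta>' else \<beta>) else (if odd l then \<beta> else \<beta>')))"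

definition digit_t :: "real \<Rightarrow> (nat \<Rightarrow> int) \<Rightarrow> nat \<Rightarrow> int" where
  "digit_t \<theta> d k = (\<Sum>j=1..k. d j * cf_q \<theta> (j - 1))"

definition digit_r :: "real \<Rightarrow> (nat \<Rightarrow> int) \<Rightarrow> nat \<Rightarrow> int" where
  "digit_r \<theta> d k = cf_q \<theta> k - digit_t \<theta> d k"

definition nu1_seq :: "real \<Rightarrow> (nat \<Rightarrow> int) \<Rightarrow> nat \<Rightarrow> real" where
  "nu1_seq \<theta> d k = 2 + of_int (digit_t \<theta> d k) / of_int (digit_r \<theta> d (k + 1))"

definition nu2_seq :: "real \<Rightarrow> (nat \<Rightarrow> int) \<Rightarrow> nat \<Rightarrow> real" where
  "nu2_seq \<theta> d k =
     2 + of_int (digit_r \<theta> d k) / of_int (digit_r \<theta> d (k + 1) + digit_t \<theta> d k)"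

definition nu3_seq :: "real \<Rightarrow> (nat \<Rightarrow> int) \<Rightarrow> nat \<Rightarrow> real" where
  "nu3_seq \<theta> d k =
     1 + of_int (cf_q \<theta> (k + 1)) / of_int (digit_r \<theta> d (k + 1) + cf_q \<theta> k)"

definition nu4_seq :: "real \<Rightarrow> (nat \<Rightarrow> int) \<Rightarrow> nat \<Rightarrow> real" where
  "nu4_seq \<theta> d k = 1 + of_int (digit_r \<theta> d (k + 2)) / of_int (cf_q \<theta> (k + 1))"

text \<open>Limit superior along the indices in \<open>K\<close>; it is \<open>-\<infinity>\<close> (hence does not contribute to a
  maximum) if \<open>K\<close> is finite.\<close>

definition limsup_along :: "nat set \<Rightarrow> (nat \<Rightarrow> real) \<Rightarrow> ereal" where
  "limsup_along K f = Limsup (inf sequentially (principal K)) (\<lambda>k. ereal (f k))"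

definition nu1 :: "real \<Rightarrow> (nat \<Rightarrow> int) \<Rightarrow> ereal" where
  "nu1 \<theta> d = limsup_along
     {k. cf_a \<theta> (k + 1) - d (k + 1) \<ge> 1 \<and> cf_a \<theta> (k + 2) - d (k + 2) \<ge> 1} (nu1_seq \<theta> d)"

definition nu2 :: "real \<Rightarrow> (nat \<Rightarrow> int) \<Rightarrow> ereal" where
  "nu2 \<theta> d = limsup_along {k. cf_a \<theta> (k + 2) - d (k + 2) \<ge> 1} (nu2_seq \<theta> d)"

definition nu3 :: "real \<Rightarrow> (nat \<Rightarrow> int) \<Rightarrow> ereal" where
  "nu3 \<theta> d = limsup (\<lambda>k. ereal (nu3_seq \<theta> d k))"

definition nu4 :: "real \<Rightarrow> (nat \<Rightarrow> int) \<Rightarrow> ereal" where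
  "nu4 \<theta> d = limsup (\<lambda>k. ereal (nu4_seq \<theta> d k))"

text \<open>Solutions are counted as rational numbers, not as pairs \<open>(p, q)\<close>; the value may be \<open>\<infinity>\<close>.\<close>

definition irrationality_exponent :: "real \<Rightarrow> ereal" where
  "irrationality_exponent \<zeta> =
     Sup {ereal \<mu> |\<mu>. infinite {x. \<exists>p q :: int. q \<ge> 1 \<and> x = of_int p / of_int q \<and>
                                    \<bar>\<zeta> - x\<bar> < of_int q powr (- \<mu>)}}"

end

theory Submission
  imports Defs
begin

text \<open>
  Put \<open>Y m = \<lfloor>(m - 1)\<theta> + \<rho>\<rfloor>\<close> (or its ceiling analogue). Summation by parts gives integers \<open>P\<close> with
  \<open>b\<^sup>U(b\<^sup>V - 1)\<xi> - P = (b - 1)\<^sup>2 \<Sum>\<^sub>m g(U + m) b\<^sup>-\<^sup>m\<close>, where \<open>g(m) = Y(m + V) - Y(m) - p\<close> and \<open>p\<close> is an integer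
  with \<open>\<bar>V\<theta> - p\<bar> < 1\<close>. All values of \<open>g\<close> lie in \<open>{0, s}\<close> for one sign \<open>s\<close>, so the left-hand side has exact
  order \<open>b\<^sup>-\<^sup>M\<close> with \<open>U + M\<close> the first \<open>m > U\<close> at which the rotation orbit hits an interval of length
  \<open>\<bar>V\<theta> - p\<bar>\<close> next to \<open>0\<close>. The Ostrowski digits and the best approximation property of the
  convergents determine these hitting times for four families \<open>(U, V)\<close>, which give approximations
  with denominators of order \<open>b\<^sup>e\<close> and \<open>M = e'\<close>, where \<open>(e, e')\<close> is \<open>(r\<^sub>k\<^sub>+\<^sub>1, r\<^sub>k\<^sub>+\<^sub>1 + t\<^sub>k)\<close>,
  \<open>(r\<^sub>k\<^sub>+\<^sub>1 + t\<^sub>k, r\<^sub>k\<^sub>+\<^sub>1 + q\<^sub>k)\<close>, \<open>(r\<^sub>k\<^sub>+\<^sub>1 + q\<^sub>k, q\<^sub>k\<^sub>+\<^sub>1)\<close> or \<open>(q\<^sub>k\<^sub>+\<^sub>1, r\<^sub>k\<^sub>+\<^sub>2)\<close>. Their exponents \<open>1 + e'/e\<close> are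
  \<open>\<nu>\<^sub>k(1), \<dots>, \<nu>\<^sub>k(4)\<close>. Since the intervals \<open>[e, e')\<close> of the valid pairs cover a neighbourhood of
  infinity, no other rational approximates \<open>\<xi>\<close> to an order exceeding their limit superior.
\<close>

section \<open>Irrationality exponents from chains of approximations\<close>

text \<open>The slack factors \<open>B\<close> and \<open>B\<^sup>2\<close> absorb all bounded constants; they do not affect the exponent.\<close>

definition good_approx :: "real \<Rightarrow> real \<Rightarrow> real \<Rightarrow> real \<Rightarrow> bool" where
  "good_approx B \<xi> e e' \<longleftrightarrow> (\<exists>P Q :: int.
     B powr (e - 1) \<le> of_int Q \<and> of_int Q \<le> B powr e \<and>
     B powr (- e') \<le> \<bar>of_int Q * \<xi> - of_int P\<bar> \<and>
     \<bar>of_int Q * \<xi> - of_int P\<bar> \<le> B powr (2 - e'))"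

definition approx_set :: "real \<Rightarrow> real \<Rightarrow> real set" where
  "approx_set \<zeta> \<mu> = {x. \<exists>p q :: int. q \<ge> 1 \<and> x = of_int p / of_int q \<and>
                                    \<bar>\<zeta> - x\<bar> < of_int q powr (- \<mu>)}"

text \<open>The lower bound in \<open>good_approx\<close> keeps \<open>P / Q\<close> different from
  \<open>\<xi>\<close>. A finite set would leave a positive minimal distance, which a large
  \<open>e\<close> undercuts.\<close>

lemma infinite_approx_set:
  fixes B \<xi> c c' :: real
  assumes B: "B \<ge> 2" and c: "0 \<le> c" "c < c'"
    and good: "\<And>K. \<exists>e e'. e \<ge> K \<and> good_approx B \<xi> e e' \<and> c' * e \<le> e + e'"
  shows "infinite (approx_set \<xi> c)"
proof
  assume fin: "finite (approx_set \<xi> c)"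
  define D where "D = insert 1 ((\<lambda>x. \<bar>\<xi> - x\<bar>) ` (approx_set \<xi> c - {\<xi>}))"
  have finD: "finite D" and neD: "D \<noteq> {}" using fin by (auto simp: D_def)
  have posD: "Min D > 0" using finD neD by (subst Min_gr_iff) (auto simp: D_def)
  \<comment> \<open>The distance is at most \<open>B powr (3 - e - e')\<close>. The second entry
    pushes this below \<open>Min D\<close>; the third gives \<open>(c' - c) * e \<ge> 4\<close>,
    which absorbs the constant 3.\<close>
  define K where "K = max 1 (max ((4 - log B (Min D)) / c') (4 / (c' - c)))"
  obtain e e' where e: "e \<ge> K" "good_approx B \<xi> e e'" "c' * e \<le> e + e'" using good by blast
  obtain P Q :: int where Q: "B powr (e - 1) \<le> of_int Q" "of_int Q \<le> B powr e"
     "B powr (- e') \<le> \<bar>of_int Q * \<xi> - of_int P\<bar>" "\<bar>of_int Q * \<xi> - of_int P\<bar> \<le> B powr (2 - e')"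
    using e(2) unfolding good_approx_def by blast
  have "0 < B powr (e - 1)" using B by simp
  then have "real_of_int Q > 0" using Q(1) by linarith
  then have Qpos: "Q \<ge> 1" and Qr: "real_of_int Q \<ge> 1" by auto
  define x where "x = of_int P / real_of_int Q"
  have dist: "\<bar>\<xi> - x\<bar> = \<bar>of_int Q * \<xi> - of_int P\<bar> / of_int Q"
    using Qr by (simp add: x_def field_simps abs_if)
  have "\<bar>\<xi> - x\<bar> \<le> B powr (2 - e') / B powr (e - 1)"
    unfolding dist using Q(1,4) B by (intro frac_le) auto
  also have "\<dots> = B powr (3 - e - e')" by (simp add: algebra_simps flip: powr_diff)
  finally have d1: "\<bar>\<xi> - x\<bar> \<le> B powr (3 - e - e')" .
  have c'pos: "c' > 0" using c by linarith
  have "4 / (c' - c) \<le> e" using e(1) by (simp add: K_def)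
  then have "4 \<le> (c' - c) * e" using c by (simp add: field_simps)
  then have "3 - e - e' < - (c * e)" using e(3) by (simp add: algebra_simps)
  then have "B powr (3 - e - e') < B powr (- (c * e))" using B by simp
  also have "\<dots> = (B powr e) powr (- c)" by (simp add: powr_powr mult.commute)
  also have "\<dots> \<le> of_int Q powr (- c)" using Q(2) Qr c by (intro powr_mono2') auto
  finally have "x \<in> approx_set \<xi> c"
    using d1 Qpos unfolding approx_set_def x_def by force
  moreover have "0 < \<bar>\<xi> - x\<bar>"
  proof -
    have "0 < B powr (- e')" using B by simp
    then have "0 < \<bar>of_int Q * \<xi> - of_int P\<bar>" using Q(3) by linarith
    then show ?thesis unfolding dist using Qr by simp
  qed
  ultimately have "\<bar>\<xi> - x\<bar> \<in> D" by (auto simp: D_def)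
  then have "Min D \<le> \<bar>\<xi> - x\<bar>" using finD by simp
  moreover have "B powr (3 - e - e') < Min D"
  proof -
    have "(4 - log B (Min D)) / c' \<le> e" using e(1) by (simp add: K_def)
    then have "4 - log B (Min D) \<le> c' * e" using c'pos by (simp add: field_simps)
    then have "3 - e - e' < log B (Min D)" using e(3) by linarith
    then have "B powr (3 - e - e') < B powr (log B (Min D))" using B by simp
    then show ?thesis using B posD by simp
  qed
  ultimately show False using d1 by linarith
qed

lemma finite_bounded_denominators:
  fixes X \<zeta> :: real
  shows "finite {x. \<exists>p q :: int. 1 \<le> q \<and> real_of_int q \<le> X \<and> x = of_int p / of_int q \<and> \<bar>\<zeta> - x\<bar> \<le> 1}"
proof (rule finite_subset)
  define R where "R = \<lceil>X * (\<bar>\<zeta>\<bar> + 1)\<rceil>"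
  show "finite ((\<lambda>(p, q). of_int p / real_of_int q) ` ({-R..R} \<times> {1..\<lfloor>X\<rfloor>}))" by simp
  show "{x. \<exists>p q :: int. 1 \<le> q \<and> real_of_int q \<le> X \<and> x = of_int p / of_int q \<and> \<bar>\<zeta> - x\<bar> \<le> 1}
     \<subseteq> (\<lambda>(p, q). of_int p / real_of_int q) ` ({-R..R} \<times> {1..\<lfloor>X\<rfloor>})"
  proof clarify
    fix p q :: int
    assume q: "1 \<le> q" "real_of_int q \<le> X" and d: "\<bar>\<zeta> - of_int p / of_int q\<bar> \<le> 1"
    have "\<bar>of_int p / real_of_int q\<bar> \<le> \<bar>\<zeta>\<bar> + 1" using d by linarith
    moreover have "\<bar>real_of_int p\<bar> = of_int q * \<bar>of_int p / real_of_int q\<bar>" using q by (simp add: abs_divide)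
    ultimately have "\<bar>real_of_int p\<bar> \<le> of_int q * (\<bar>\<zeta>\<bar> + 1)"
      using q by (metis mult_left_mono of_int_0_le_iff order_trans zero_le_one)
    also have "\<dots> \<le> X * (\<bar>\<zeta>\<bar> + 1)" using q by (intro mult_right_mono) auto
    also have "\<dots> \<le> of_int R" unfolding R_def by linarith
    finally have "\<bar>p\<bar> \<le> R" by (simp flip: of_int_abs)
    then have "p \<in> {-R..R}" by (simp add: abs_le_iff)
    moreover have "q \<in> {1..\<lfloor>X\<rfloor>}" using q by (simp add: le_floor_iff)
    ultimately show "of_int p / of_int q \<in> (\<lambda>(p, q). of_int p / real_of_int q) ` ({-R..R} \<times> {1..\<lfloor>X\<rfloor>})"
      by force
  qed
qed

text \<open>Treats a denominator \<open>q\<close> inside the window of one pair: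
  \<open>large\<close> makes \<open>q * \<bar>Q * \<xi> - P\<bar>\<close> less than 1/2, and
  \<open>small\<close> bounds \<open>Q\<close> by a constant times \<open>q\<close>.\<close>

lemma good_approx_lower_bound:
  fixes B \<xi> \<nu> e e' :: real and p q :: int
  assumes B: "B \<ge> 2" and nu: "2 \<le> \<nu>" and q: "q \<ge> 1"
    and good: "good_approx B \<xi> e e'" and ee: "e + e' \<le> \<nu> * e"
    and large: "2 * B ^ 2 * of_int q < B powr e'" and small: "B powr e \<le> 2 * B ^ 3 * of_int q"
  shows "(4 * B ^ 3 * of_int q) powr (- \<nu>) \<le> \<bar>\<xi> - of_int p / of_int q\<bar>"
proof -
  obtain P Q :: int where Q: "B powr (e - 1) \<le> of_int Q" "of_int Q \<le> B powr e"
     "B powr (- e') \<le> \<bar>of_int Q * \<xi> - of_int P\<bar>" "\<bar>of_int Q * \<xi> - of_int P\<bar> \<le> B powr (2 - e')"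
    using good unfolding good_approx_def by blast
  have "0 < B powr (e - 1)" using B by simp
  then have "real_of_int Q > 0" using Q(1) by linarith
  then have Qr: "real_of_int Q \<ge> 1" by auto
  have qr: "real_of_int q \<ge> 1" using q by simp
  have B3: "B ^ 3 \<ge> 1" using B by simp
  have B3q: "B ^ 3 * of_int q \<ge> 1" using B B3 qr mult_mono[of 1 "B^3" 1 "of_int q"] by simp
  have QB: "real_of_int Q \<le> 2 * B ^ 3 * of_int q" using Q(2) small by linarith
  \<comment> \<open>If the fractions differ, \<open>\<bar>pQ - qP\<bar> \<ge> 1\<close> forces exponent 2. If they agree, \<open>q\<close> is still at least
    of order \<open>Q\<close>, so \<open>P/Q\<close> need not be in lowest terms.\<close>
  show ?thesis
  proof (cases "p * Q = q * P")
    case False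
    define E where "E = \<bar>of_int q * \<xi> - of_int p\<bar>"
    have "\<bar>p * Q - q * P\<bar> \<ge> 1" using False by linarith
    then have "1 \<le> \<bar>real_of_int (p * Q - q * P)\<bar>" by (metis of_int_1_le_iff of_int_abs)
    also have "real_of_int (p * Q - q * P)
        = of_int q * (of_int Q * \<xi> - of_int P) - of_int Q * (of_int q * \<xi> - of_int p)"
      by (simp add: algebra_simps)
    also have "\<bar>\<dots>\<bar> \<le> of_int q * \<bar>of_int Q * \<xi> - of_int P\<bar> + of_int Q * E"
      unfolding E_def using qr Qr by (intro order_trans[OF abs_triangle_ineq4]) (simp add: abs_mult)
    also have "of_int q * \<bar>of_int Q * \<xi> - of_int P\<bar> \<le> of_int q * (B powr (2 - e'))"
      using Q(4) qr by (intro mult_left_mono) auto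
    also have "\<dots> = of_int q * (B ^ 2 / B powr e')"
      using B by (simp add: powr_diff)
    also have "\<dots> < 1 / 2" using large B by (simp add: field_simps)
    finally have "1 / 2 < of_int Q * E" by linarith
    also have "\<dots> \<le> 2 * B ^ 3 * of_int q * E" using QB by (intro mult_right_mono) (auto simp: E_def)
    finally have "1 / (4 * B ^ 3 * of_int q) < E" using B3q by (simp add: field_simps)
    then have "1 / (4 * B ^ 3 * of_int q) / of_int q < E / of_int q" using qr 
      by (intro divide_strict_right_mono) auto
    moreover have "E / of_int q = \<bar>\<xi> - of_int p / of_int q\<bar>"
      unfolding E_def using qr by (simp add: field_simps abs_if)
    moreover have "(4 * B ^ 3 * of_int q) powr (- \<nu>) \<le> 1 / (4 * B ^ 3 * of_int q) / of_int q"
    proof -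
      have "(4 * B ^ 3 * of_int q) powr (- \<nu>) \<le> (4 * B ^ 3 * of_int q) powr (- 2)"
        using nu B3q by (intro powr_mono) auto
      also have "\<dots> = 1 / (4 * B ^ 3 * of_int q) / (4 * B ^ 3 * of_int q)"
        using B B3q qr by (subst powr_minus_divide, subst powr_numeral) (auto simp: power2_eq_square)
      also have "\<dots> \<le> 1 / (4 * B ^ 3 * of_int q) / of_int q"
        using B3q B3 qr by (intro divide_left_mono) (auto simp: field_simps)
      finally show ?thesis .
    qed
    ultimately show ?thesis by linarith
  next
    case True
    then have "real_of_int p * of_int Q = of_int q * of_int P" by (metis of_int_mult)
    then have "of_int p / of_int q = of_int P / real_of_int Q" using Qr qr by (simp add: field_simps)
    then have "\<bar>\<xi> - of_int p / of_int q\<bar> = \<bar>\<xi> - of_int P / of_int Q\<bar>" by simp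
    also have "\<dots> = \<bar>of_int Q * \<xi> - of_int P\<bar> / of_int Q"
      using Qr by (simp add: field_simps abs_if)
    also have "\<dots> \<ge> B powr (- e') / B powr e"
      using Q Qr B by (intro frac_le) auto
    also have "B powr (- e') / B powr e = B powr (- (e + e'))" by (subst powr_diff[symmetric]) (rule arg_cong[where f = "\<lambda>z. B powr z"], simp)
    finally have "B powr (- (e + e')) \<le> \<bar>\<xi> - of_int p / of_int q\<bar>" .
    moreover have "B powr (- (\<nu> * e)) \<le> B powr (- (e + e'))" using ee B by simp
    moreover have "B powr (- (\<nu> * e)) = (B powr e) powr (- \<nu>)" by (simp add: powr_powr mult.commute)
    moreover have "(4 * B ^ 3 * of_int q) powr (- \<nu>) \<le> (B powr e) powr (- \<nu>)"
      using small nu B B3q by (intro powr_mono2') auto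
    ultimately show ?thesis by linarith
  qed
qed

lemma finite_approx_set:
  fixes B \<xi> \<nu> \<mu> :: real and ymin :: nat
  assumes B: "B \<ge> 2" and nu: "2 \<le> \<nu>" "\<nu> < \<mu>"
    and cover: "\<And>y :: nat. y \<ge> ymin \<Longrightarrow> 
      \<exists>e e' :: real. good_approx B \<xi> e e' \<and> e \<le> real y \<and> real y < e' \<and> e + e' \<le> \<nu> * e"
  shows "finite (approx_set \<xi> \<mu>)"
proof (rule finite_subset[OF _ finite_bounded_denominators])
  \<comment> \<open>The first entry pushes the exponent \<open>y\<close> chosen below beyond
    \<open>ymin\<close>; the second is the \<open>q\<close> at which
    \<open>(4 * B ^ 3 * q) powr (- \<nu>)\<close> and \<open>q powr (- \<mu>)\<close>
    balance.\<close>
  define X where "X = max (B ^ ymin) ((4 * B ^ 3) powr (\<nu> / (\<mu> - \<nu>)))"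
  show "approx_set \<xi> \<mu> \<subseteq> {x. \<exists>p q :: int. 1 \<le> q \<and> real_of_int q \<le> X \<and> x = of_int p / of_int q \<and> \<bar>\<xi> - x\<bar> \<le> 1}"
  proof
    fix x assume "x \<in> approx_set \<xi> \<mu>"
    then obtain p q :: int where q: "q \<ge> 1" and x: "x = of_int p / of_int q"
      and d: "\<bar>\<xi> - x\<bar> < of_int q powr (- \<mu>)" unfolding approx_set_def by blast
    have qr: "real_of_int q \<ge> 1" using q by simp
    have "of_int q powr (- \<mu>) \<le> of_int q powr 0" using qr nu by (intro powr_mono) auto
    then have d1: "\<bar>\<xi> - x\<bar> \<le> 1" using d qr by simp
    have "real_of_int q \<le> X"
    proof (rule ccontr)
      assume "\<not> real_of_int q \<le> X"
      then have qX: "B ^ ymin < of_int q" "(4 * B ^ 3) powr (\<nu> / (\<mu> - \<nu>)) < of_int q"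
        by (auto simp: X_def)
      \<comment> \<open>Chosen so that any window with \<open>e \<le> y < e'\<close> meets both size
        conditions: \<open>w \<le> B powr y < B powr e'\<close> and
        \<open>B powr e \<le> B * w\<close>.\<close>
      define w where "w = 2 * B ^ 2 * of_int q"
      have B2: "1 \<le> B ^ 2" using B by simp
      have "1 * of_int q \<le> (2 * B ^ 2) * of_int q" using B2 qr by (intro mult_right_mono) linarith+
      then have wq: "w \<ge> of_int q" by (simp add: w_def)
      then have w1: "w \<ge> 1" using qr by linarith
      define y where "y = nat \<lceil>log B w\<rceil>"
      have lw: "log B w \<ge> 0" using w1 B by simp
      have y: "log B w \<le> y" "y < log B w + 1" unfolding y_def using lw by linarith+
      have "real ymin = log B (B ^ ymin)" using B by (simp add: log_nat_power)
      also have "\<dots> \<le> log B w" using qX(1) wq B w1 by (subst log_le_cancel_iff) auto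
      finally have "y \<ge> ymin" using y by linarith
      then obtain e e' :: real where e: "good_approx B \<xi> e e'" "e \<le> y" "y < e'" "e + e' \<le> \<nu> * e"
        using cover by blast
      have "w = B powr log B w" using B w1 by simp
      also have "\<dots> < B powr e'" using y e(3) B by simp
      finally have large: "2 * B ^ 2 * of_int q < B powr e'" by (simp add: w_def)
      have "B powr e \<le> B powr (log B w + 1)" using y e(2) B by simp
      also have "\<dots> = 2 * B ^ 3 * of_int q" using B w1 by (simp add: powr_add w_def power3_eq_cube power2_eq_square)
      finally have small: "B powr e \<le> 2 * B ^ 3 * of_int q" .
      have "(4 * B ^ 3 * of_int q) powr (- \<nu>) < of_int q powr (- \<mu>)"
        using good_approx_lower_bound[OF B nu(1) q e(1,4) large small, of p] d x by linarith
      then have "(4 * B ^ 3) powr (- \<nu>) * of_int q powr (- \<nu>) < of_int q powr (- \<mu>)"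
        using B qr by (simp add: powr_mult)
      then have "of_int q powr (\<mu> - \<nu>) < (4 * B ^ 3) powr \<nu>"
        using B qr by (simp add: powr_minus powr_diff field_simps)
      then have "(of_int q powr (\<mu> - \<nu>)) powr (1 / (\<mu> - \<nu>)) < ((4 * B ^ 3) powr \<nu>) powr (1 / (\<mu> - \<nu>))"
        using nu qr by (intro powr_less_mono2) auto
      then have "of_int q < (4 * B ^ 3) powr (\<nu> / (\<mu> - \<nu>))"
        using nu qr by (simp add: powr_powr)
      then show False using qX by linarith
    qed
    then show "x \<in> {x. \<exists>p q :: int. 1 \<le> q \<and> real_of_int q \<le> X \<and> x = of_int p / of_int q \<and> \<bar>\<xi> - x\<bar> \<le> 1}"
      using q x d1 by blast
  qed
qed

section \<open>Approximations from almost periodic digit expansions\<close>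

lemma geometric_Suc_sums:
  fixes B :: real assumes "B \<ge> 2"
  shows "(\<lambda>n. 1 / B ^ Suc n) sums (1 / (B - 1))"
proof -
  have "(\<lambda>n. 1 / B * (1 / B) ^ n) sums (1 / B * (1 / (1 - 1 / B)))"
    using assms by (intro sums_mult geometric_sums) auto
  then show ?thesis using assms by (simp add: field_simps power_one_over)
qed

lemma good_approx_of_first_hit:
  fixes b p s :: int and Y :: "nat \<Rightarrow> int" and \<xi> :: real and U V M :: nat
  assumes b: "b \<ge> 2"
    and sm: "summable (\<lambda>n. of_int (Y (Suc n)) / real_of_int b ^ Suc n)"
    and xi: "\<xi> = (of_int b - 1) * (\<Sum>n. of_int (Y (Suc (Suc n)) - Y (Suc n)) / of_int b ^ Suc n)"
    and V: "V \<ge> 1" and M: "M \<ge> 1" and s: "\<bar>s\<bar> = 1"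
    and g: "\<And>m. m > U \<Longrightarrow> Y (m + V) - Y m - p \<in> {0, s}"
    and nohit: "\<And>m. U < m \<Longrightarrow> m < U + M \<Longrightarrow> Y (m + V) - Y m = p"
    and hit: "Y (U + M + V) - Y (U + M) = p + s"
  shows "good_approx (of_int b) \<xi> (real (U + V)) (real M)"
proof -
  define B where "B = real_of_int b"
  have B: "B \<ge> 2" using b by (simp add: B_def)
  define f where "f n = real_of_int (Y (Suc n)) / B ^ Suc n" for n
  define G where "G = suminf f"
  have smf: "summable f" using sm by (simp add: f_def[abs_def] B_def)
  \<comment> \<open>Multiplying \<open>G\<close> by \<open>B ^ u\<close> shifts the index by
    \<open>u\<close> and splits off an integer, since the first \<open>u\<close> denominators divide
    \<open>b ^ u\<close>.\<close>
  have tail: "\<exists>i :: int. (\<lambda>n. of_int (Y (Suc n + u)) / B ^ Suc n) sums (B ^ u * G - of_int i)" for u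
  proof -
    have "(\<lambda>n. f (n + u)) sums (G - (\<Sum>n<u. f n))"
      unfolding G_def using smf by (simp add: sums_iff suminf_minus_initial_segment summable_ignore_initial_segment)
    then have "(\<lambda>n. B ^ u * f (n + u)) sums (B ^ u * (G - (\<Sum>n<u. f n)))" by (rule sums_mult)
    moreover have "(\<lambda>n. B ^ u * f (n + u)) = (\<lambda>n. of_int (Y (Suc n + u)) / B ^ Suc n)"
      using B by (auto simp: f_def power_add)
    moreover have "B ^ u * (\<Sum>n<u. f n) = of_int (\<Sum>n<u. Y (Suc n) * b ^ (u - Suc n))"
    proof -
      have "B ^ u * f n = of_int (Y (Suc n) * b ^ (u - Suc n))" if "n < u" for n
      proof -
        have "B ^ u = B ^ (u - Suc n) * B ^ Suc n" using that by (metis Suc_leI le_add_diff_inverse2 power_add)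
        then show ?thesis using B by (simp add: f_def B_def)
      qed
      then show ?thesis by (simp add: sum_distrib_left)
    qed
    ultimately have "(\<lambda>n. of_int (Y (Suc n + u)) / B ^ Suc n) sums
        (B ^ u * G - of_int (\<Sum>n<u. Y (Suc n) * b ^ (u - Suc n)))"
      by (simp only: right_diff_distrib)
    then show ?thesis by blast
  qed
  \<comment> \<open>Abel summation: differencing contributes one factor \<open>B - 1\<close>, the
    prefactor of \<open>\<xi>\<close> the other.\<close>
  have xiG: "\<xi> = (B - 1)\<^sup>2 * G - (B - 1) * of_int (Y 1)"
  proof -
    have "(\<lambda>n. f (n + 1)) sums (G - of_int (Y 1) / B)"
      unfolding G_def using summable_sums[OF smf] sums_Suc_iff[of f "suminf f - f 0"] by (simp add: f_def)
    then have "(\<lambda>n. B * f (n + 1)) sums (B * (G - of_int (Y 1) / B))" by (rule sums_mult)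
    moreover have "f sums G" unfolding G_def using smf by (rule summable_sums)
    ultimately have "(\<lambda>n. B * f (n + 1) - f n) sums (B * (G - of_int (Y 1) / B) - G)" by (rule sums_diff)
    moreover have "(\<lambda>n. B * f (n + 1) - f n) = (\<lambda>n. of_int (Y (Suc (Suc n)) - Y (Suc n)) / B ^ Suc n)"
      using B by (auto simp: f_def field_simps)
    ultimately have "(\<Sum>n. of_int (Y (Suc (Suc n)) - Y (Suc n)) / B ^ Suc n) = B * (G - of_int (Y 1) / B) - G"
      by (simp add: sums_iff)
    then have "\<xi> = (B - 1) * (B * (G - of_int (Y 1) / B) - G)" using xi by (simp add: B_def)
    also have "\<dots> = (B - 1)\<^sup>2 * G - (B - 1) * of_int (Y 1)"
      using B by (simp add: field_simps power2_eq_square)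
    finally show ?thesis .
  qed
  \<comment> \<open>The sign \<open>s\<close> normalises the values to 0 and 1. Index
    \<open>n\<close> stands for time \<open>U + Suc n\<close>, so the first 1 sits at
    \<open>M - 1\<close>.\<close>
  define h where "h n = s * (Y (Suc n + U + V) - Y (Suc n + U) - p)" for n
  have ss: "s * s = 1" using s by (metis abs_mult_self_eq mult.right_neutral)
  have h01: "h n \<in> {0, 1}" for n using g[of "Suc n + U"] ss by (auto simp: h_def)
  have h0: "h n = 0" if "n < M - 1" for n
    using nohit[of "Suc n + U"] that by (simp add: h_def)
  have h1: "h (M - 1) = 1"
    using hit M ss by (simp add: h_def add.commute)
  define T where "T = (\<Sum>n. of_int (h n) / B ^ Suc n)"
  obtain i1 i2 :: int where i1: "(\<lambda>n. of_int (Y (Suc n + (U + V))) / B ^ Suc n) sums (B ^ (U + V) * G - of_int i1)"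
    and i2: "(\<lambda>n. of_int (Y (Suc n + U)) / B ^ Suc n) sums (B ^ U * G - of_int i2)"
    using tail by meson
  have Tsum: "(\<lambda>n. of_int (h n) / B ^ Suc n) sums
     (of_int s * ((B ^ (U + V) * G - of_int i1) - (B ^ U * G - of_int i2) - of_int p * (1 / (B - 1))))"
  proof -
    have "(\<lambda>n. of_int s * (of_int (Y (Suc n + (U + V))) / B ^ Suc n - of_int (Y (Suc n + U)) / B ^ Suc n
             - of_int p * (1 / B ^ Suc n))) sums
     (of_int s * ((B ^ (U + V) * G - of_int i1) - (B ^ U * G - of_int i2) - of_int p * (1 / (B - 1))))"
      by (intro sums_mult sums_diff i1 i2 geometric_Suc_sums B)
    moreover have "(\<lambda>n. of_int s * (of_int (Y (Suc n + (U + V))) / B ^ Suc n - of_int (Y (Suc n + U)) / B ^ Suc n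
             - of_int p * (1 / B ^ Suc n))) = (\<lambda>n. of_int (h n) / B ^ Suc n)"
      by (simp add: h_def add.assoc diff_divide_distrib right_diff_distrib)
    ultimately show ?thesis by simp
  qed
  define Q where "Q = b ^ U * (b ^ V - 1)"
  \<comment> \<open>Everything integral: the heads split off by \<open>tail\<close>, the geometric
    series of the constant \<open>p\<close>, and the \<open>Y 1\<close> term of
    \<open>xiG\<close>.\<close>
  define P where "P = (b - 1)\<^sup>2 * (i1 - i2) + p * (b - 1) - Q * ((b - 1) * Y 1)"
  have "of_int Q * \<xi> - of_int P = of_int s * ((B - 1)\<^sup>2 * T)"
  proof -
    have T: "T = of_int s * ((B ^ (U + V) * G - of_int i1) - (B ^ U * G - of_int i2) - of_int p * (1 / (B - 1)))"
      using Tsum unfolding T_def by (simp add: sums_iff)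
    have "of_int s * ((B - 1)\<^sup>2 * T) = of_int (s * s) *
       ((B - 1)\<^sup>2 * ((B ^ (U + V) * G - of_int i1) - (B ^ U * G - of_int i2) - of_int p * (1 / (B - 1))))"
      unfolding T by simp
    also have "\<dots> = of_int Q * ((B - 1)\<^sup>2 * G) - (B - 1)\<^sup>2 * (of_int i1 - of_int i2) - of_int p * (B - 1)"
      unfolding ss using B by (simp add: Q_def power_add field_simps power2_eq_square flip: B_def)
    also have "\<dots> = of_int Q * \<xi> - of_int P"
      unfolding xiG P_def by (simp add: algebra_simps flip: B_def)
    finally show ?thesis ..
  qed
  moreover have Tlo: "1 / B ^ M \<le> T"
  proof -
    have "summable (\<lambda>n. of_int (h n) / B ^ Suc n)" using Tsum by (rule sums_summable)
    then have "sum (\<lambda>n. of_int (h n) / B ^ Suc n) {M - 1} \<le> T"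
      unfolding T_def
    proof (rule sum_le_suminf)
      fix n
      show "0 \<le> of_int (h n) / B ^ Suc n" using h01[of n] B by auto
    qed auto
    then show ?thesis using h1 M by simp
  qed
  moreover have "T \<le> B / (B - 1) * (1 / B ^ M)"
  proof -
    have sT: "summable (\<lambda>n. of_int (h n) / B ^ Suc n)" using Tsum by (rule sums_summable)
    have "T = (\<Sum>n. of_int (h (n + (M - 1))) / B ^ Suc (n + (M - 1)))"
      unfolding T_def using suminf_split_initial_segment[OF sT, of "M - 1"] h0 by simp
    also have "\<dots> \<le> (\<Sum>n. 1 / B ^ Suc n * (1 / B ^ (M - 1)))"
    proof (rule suminf_le)
      show "of_int (h (n + (M - 1))) / B ^ Suc (n + (M - 1)) \<le> 1 / B ^ Suc n * (1 / B ^ (M - 1))" for n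
      proof -
        have "of_int (h (n + (M - 1))) \<le> (1 :: real)" using h01[of "n + (M - 1)"] by auto
        then have "of_int (h (n + (M - 1))) / B ^ Suc (n + (M - 1)) \<le> 1 / B ^ Suc (n + (M - 1))"
          using B by (intro divide_right_mono) auto
        then show ?thesis by (simp add: power_add)
      qed
      show "summable (\<lambda>n. of_int (h (n + (M - 1))) / B ^ Suc (n + (M - 1)))"
        using summable_ignore_initial_segment[OF sT] .
      show "summable (\<lambda>n. 1 / B ^ Suc n * (1 / B ^ (M - 1)))"
        using geometric_Suc_sums[OF B] by (intro summable_mult2 sums_summable)
    qed
    also have "\<dots> = 1 / (B - 1) * (1 / B ^ (M - 1))"
      by (rule sums_unique[symmetric]) (intro sums_mult2 geometric_Suc_sums B)
    also have "\<dots> = B / (B - 1) * (1 / B ^ M)"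
      using M B by (cases M) auto
    finally show ?thesis .
  qed
  moreover have "\<bar>of_int s * ((B - 1)\<^sup>2 * T)\<bar> = (B - 1)\<^sup>2 * T"
  proof -
    have "0 \<le> 1 / B ^ M" using B by simp
    then have "T \<ge> 0" using Tlo by linarith
    then show ?thesis using s by (simp add: abs_mult flip: of_int_abs)
  qed
  ultimately have abs: "\<bar>of_int Q * \<xi> - of_int P\<bar> = (B - 1)\<^sup>2 * T"
    and T: "1 / B ^ M \<le> T" "T \<le> B / (B - 1) * (1 / B ^ M)" by simp_all
  have Bm: "B powr (- real M) = 1 / B ^ M" using B by (simp add: powr_minus_divide powr_realpow)
  have B1: "(B - 1)\<^sup>2 \<ge> 1" using B by (simp add: one_le_power)
  show ?thesis unfolding good_approx_def B_def[symmetric]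
  proof (rule exI[of _ P], rule exI[of _ Q], intro conjI)
    have QB: "of_int Q = B ^ U * (B ^ V - 1)" by (simp add: Q_def B_def)
    have "B ^ V = B * B ^ (V - 1)" using V by (cases V) auto
    moreover have "B ^ (V - 1) \<ge> 1" using B by (intro one_le_power) auto
    moreover have "B * B ^ (V - 1) \<ge> 2 * B ^ (V - 1)" using B by (intro mult_right_mono) auto
    ultimately have "B ^ (V - 1) \<le> B ^ V - 1" by linarith
    then have "B ^ U * B ^ (V - 1) \<le> of_int Q" unfolding QB using B by (intro mult_left_mono) auto
    moreover have "B powr (real (U + V) - 1) = B ^ U * B ^ (V - 1)"
    proof -
      have "real (U + V) - 1 = real (U + (V - 1))" using V by simp
      then show ?thesis using B by (simp only: powr_realpow power_add)
    qed
    ultimately show "B powr (real (U + V) - 1) \<le> of_int Q" by simp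
    have "of_int Q \<le> B ^ (U + V)" unfolding QB using B by (simp add: power_add algebra_simps)
    then show "of_int Q \<le> B powr real (U + V)" using B by (simp only: powr_realpow)
    have "1 / B ^ M \<le> (B - 1)\<^sup>2 * T" using mult_mono[OF B1 T(1)] B by simp
    then show "B powr - real M \<le> \<bar>of_int Q * \<xi> - of_int P\<bar>" unfolding abs Bm .
    \<comment> \<open>The total constant \<open>(B - 1) * B\<close> is below \<open>B ^ 2\<close>,
      whence the exponent \<open>2 - e'\<close> in \<open>good_approx\<close>.\<close>
    have "(B - 1)\<^sup>2 * T \<le> (B - 1)\<^sup>2 * (B / (B - 1) * (1 / B ^ M))" using T(2) by (intro mult_left_mono) auto
    also have "\<dots> = (B - 1) * B * (1 / B ^ M)" using B by (simp add: power2_eq_square)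
    also have "\<dots> \<le> B * B * (1 / B ^ M)" using B by (intro mult_right_mono) auto
    also have "\<dots> = B powr (2 - real M)" using B by (simp add: powr_diff powr_realpow power2_eq_square)
    finally show "\<bar>of_int Q * \<xi> - of_int P\<bar> \<le> B powr (2 - real M)" unfolding abs .
  qed
qed

section \<open>Continued fractions\<close>

lemma minus_one_power_mult_self: "(-1) ^ k * ((-1) ^ k * x) = (x :: real)"
  by (simp flip: mult.assoc power_mult_distrib)

locale irrational_cf =
  fixes \<theta> :: real
  assumes theta: "0 < \<theta>" "\<theta> < 1" "\<theta> \<notin> \<rat>"
begin

abbreviation "a \<equiv> cf_a \<theta>"
abbreviation "q \<equiv> cf_q \<theta>"
abbreviation "p \<equiv> cf_p \<theta>"

text \<open>The signs of \<open>cf_theta\<close> alternate, so this is its absolute value.\<close>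

definition eta :: "nat \<Rightarrow> real" where "eta k = (-1) ^ k * cf_theta \<theta> k"

lemma gauss_iter_bounds: "0 < gauss_iter \<theta> k \<and> gauss_iter \<theta> k < 1 \<and> gauss_iter \<theta> k \<notin> \<rat>"
proof (induction k)
  case 0
  then show ?case using theta by simp
next
  case (Suc k)
  let ?g = "gauss_iter \<theta> k"
  have "1 / ?g \<notin> \<rat>"
  proof
    assume "1 / ?g \<in> \<rat>"
    then have "inverse (1 / ?g) \<in> \<rat>" by (rule Rats_inverse)
    then show False using Suc by simp
  qed
  then have "frac (1 / ?g) \<notin> \<rat>"
    unfolding frac_def by (metis Rats_add Rats_of_int diff_add_cancel)
  moreover from this have "frac (1 / ?g) \<noteq> 0" by (metis Rats_0)
  ultimately show ?case using frac_lt_1[of "1 / ?g"] frac_ge_0[of "1 / ?g"] by simp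
qed

lemma a_ge_1: "k \<ge> 1 \<Longrightarrow> a k \<ge> 1"
proof -
  assume "k \<ge> 1"
  then obtain j where k: "k = Suc j" by (cases k) auto
  have "1 \<le> 1 / gauss_iter \<theta> j" using gauss_iter_bounds[of j] by simp
  then show ?thesis unfolding k by (simp add: le_floor_iff)
qed

lemma q_Suc_Suc: "q (Suc (Suc k)) = a (Suc (Suc k)) * q (Suc k) + q k" by simp
lemma p_Suc_Suc: "p (Suc (Suc k)) = a (Suc (Suc k)) * p (Suc k) + p k" by simp
lemma a_Suc: "a (Suc k) = \<lfloor>1 / gauss_iter \<theta> k\<rfloor>" by simp

declare cf_a.simps(2) [simp del] cf_q.simps(3) [simp del] cf_p.simps(3) [simp del]

lemma q_pos: "q k \<ge> 1"
proof -
  have "q k \<ge> 1 \<and> q (Suc k) \<ge> 1"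
  proof (induction k)
    case 0
    then show ?case using a_ge_1[of 1] by simp
  next
    case (Suc k)
    have "q (Suc (Suc k)) \<ge> 1 * q (Suc k) + q k"
      unfolding q_Suc_Suc using Suc a_ge_1[of "Suc (Suc k)"] by (intro add_mono mult_right_mono) auto
    then show ?case using Suc by simp
  qed
  then show ?thesis by simp
qed

lemma q_Suc_Suc_ge: "q (Suc (Suc k)) \<ge> q (Suc k) + q k"
proof -
  have "q (Suc (Suc k)) \<ge> 1 * q (Suc k) + q k"
    unfolding q_Suc_Suc using q_pos[of "Suc k"] a_ge_1[of "Suc (Suc k)"]
    by (intro add_mono mult_right_mono) auto
  then show ?thesis by simp
qed

lemma q_mono_Suc: "q k \<le> q (Suc k)"
  using q_Suc_Suc_ge[of "k - 1"] q_pos[of "k - 1"] q_pos[of "Suc k"] by (cases k) auto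

lemma q_ge_index: "q k \<ge> int k"
proof (induction k)
  case (Suc k)
  show ?case
  proof (cases k)
    case 0
    then show ?thesis using q_pos[of 1] by simp
  next
    case (Suc j)
    then show ?thesis using Suc.IH q_Suc_Suc_ge[of j] q_pos[of j] by simp
  qed
qed simp

lemma cf_theta_Suc_Suc:
  "cf_theta \<theta> (Suc (Suc k)) = of_int (a (Suc (Suc k))) * cf_theta \<theta> (Suc k) + cf_theta \<theta> k"
  by (simp add: cf_theta_def q_Suc_Suc p_Suc_Suc algebra_simps)

text \<open>The Gauss iterates are the ratios of consecutive absolute values: dividing the
  recurrence by \<open>cf_theta \<theta> (Suc k)\<close> turns it into the Gauss map.\<close>

lemma cf_theta_Suc: "cf_theta \<theta> (Suc k) = - gauss_iter \<theta> (Suc k) * cf_theta \<theta> k"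
proof (induction k)
  case 0
  show ?case using theta by (simp add: cf_theta_def frac_def a_Suc field_simps)
next
  case (Suc k)
  have g: "gauss_iter \<theta> (Suc k) > 0" using gauss_iter_bounds by blast
  have k: "cf_theta \<theta> k = - (cf_theta \<theta> (Suc k) / gauss_iter \<theta> (Suc k))"
    using Suc g by (simp del: gauss_iter.simps)
  have "gauss_iter \<theta> (Suc (Suc k)) = 1 / gauss_iter \<theta> (Suc k) - of_int (a (Suc (Suc k)))"
    by (simp add: frac_def a_Suc)
  then show ?case unfolding cf_theta_Suc_Suc[of k] k
    by (simp only:) (simp add: left_diff_distrib del: gauss_iter.simps)
qed

lemma eta_Suc: "eta (Suc k) = gauss_iter \<theta> (Suc k) * eta k"
  by (simp add: eta_def cf_theta_Suc del: gauss_iter.simps)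

lemma eta_pos: "eta k > 0"
proof (induction k)
  case 0
  then show ?case using theta by (simp add: eta_def cf_theta_def)
next
  case (Suc k)
  then show ?case unfolding eta_Suc using gauss_iter_bounds by (intro mult_pos_pos) blast+
qed

lemma eta_Suc_less: "eta (Suc k) < eta k"
  unfolding eta_Suc using eta_pos[of k] gauss_iter_bounds[of "Suc k"] by simp

lemma eta_less_1: "eta k < 1"
proof (induction k)
  case 0
  then show ?case using theta by (simp add: eta_def cf_theta_def)
next
  case (Suc k)
  then show ?case using eta_Suc_less[of k] by linarith
qed

lemma eta_Suc_Suc: "eta (Suc (Suc k)) = eta k - of_int (a (Suc (Suc k))) * eta (Suc k)"
  by (simp add: eta_def cf_theta_Suc_Suc algebra_simps)

lemma cf_theta_eta: "cf_theta \<theta> k = (-1) ^ k * eta k"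
  by (simp add: eta_def minus_one_power_mult_self)

lemma cf_theta_Suc_eta: "(-1) ^ k * cf_theta \<theta> (Suc k) = - eta (Suc k)"
  by (simp add: eta_def)

section \<open>Determinant identity and best approximation\<close>

lemma unimodular: "q (Suc k) * p k - q k * p (Suc k) = (-1) ^ Suc k"
proof (induction k)
  case (Suc k)
  have "q (Suc (Suc k)) * p (Suc k) - q (Suc k) * p (Suc (Suc k)) = - (q (Suc k) * p k - q k * p (Suc k))"
    by (simp add: q_Suc_Suc p_Suc_Suc algebra_simps)
  then show ?case using Suc by simp
qed simp

lemma q_eta: "of_int (q (Suc k)) * eta k + of_int (q k) * eta (Suc k) = 1"
proof -
  have "real_of_int (q (Suc k)) * eta k + of_int (q k) * eta (Suc k)
      = - ((-1) ^ k * of_int (q (Suc k) * p k - q k * p (Suc k)))"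
    by (simp add: eta_def cf_theta_def algebra_simps)
  also have "\<dots> = 1" unfolding unimodular by (simp flip: power_mult_distrib)
  finally show ?thesis .
qed

lemma eta_le_inverse: "eta k \<le> 1 / real (Suc k)"
proof -
  have "real (Suc k) * eta k \<le> of_int (q (Suc k)) * eta k"
    using q_ge_index[of "Suc k"] eta_pos[of k] by (intro mult_right_mono) linarith+
  also have "\<dots> \<le> 1"
    using q_eta[of k] eta_pos[of "Suc k"] q_pos[of k] by (smt (verit) mult_nonneg_nonneg of_int_1_le_iff)
  finally show ?thesis by (simp add: field_simps)
qed

lemma int_mult_theta_eq: "of_int n * \<theta> = of_int i \<Longrightarrow> n = 0"
proof (rule ccontr)
  assume e: "of_int n * \<theta> = of_int i" and "n \<noteq> 0"
  then have "\<theta> = of_int i / of_int n" by (simp add: field_simps)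
  then show False using theta(3) by (metis Rats_divide Rats_of_int)
qed

text \<open>By \<open>unimodular\<close> the convergent pairs at \<open>k\<close> and
  \<open>Suc k\<close> form a basis of the integer lattice. For coordinates \<open>u\<close>,
  \<open>v\<close> the distance is \<open>\<bar>u * eta k - v * eta (Suc k)\<bar>\<close>: opposite
  signs make it at least \<open>eta k\<close>, while equal signs make \<open>\<bar>n\<bar>\<close>
  at least \<open>q (Suc k)\<close>.\<close>

lemma best_approximation:
  fixes n i :: int
  assumes n: "\<bar>n\<bar> < q (Suc k)" and ni: "\<bar>of_int n * \<theta> - of_int i\<bar> < eta k"
  shows "n = 0"
proof -
  \<comment> \<open>Cramer's rule; the determinant \<open>e\<close> is its own inverse.\<close>
  define e :: int where "e = (-1) ^ Suc k"
  have ee: "e * e = 1" by (simp add: e_def flip: power_mult_distrib)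
  define u where "u = e * (q (Suc k) * i - p (Suc k) * n)"
  define v where "v = e * (p k * n - q k * i)"
  have "u * q k + v * q (Suc k) = e * (q (Suc k) * p k - q k * p (Suc k)) * n"
    by (simp add: u_def v_def algebra_simps)
  then have nq: "n = u * q k + v * q (Suc k)" unfolding unimodular using ee by (simp add: e_def)
  have "u * p k + v * p (Suc k) = e * (q (Suc k) * p k - q k * p (Suc k)) * i"
    by (simp add: u_def v_def algebra_simps)
  then have ip: "i = u * p k + v * p (Suc k)" unfolding unimodular using ee by (simp add: e_def)
  have "of_int n * \<theta> - of_int i = of_int u * cf_theta \<theta> k + of_int v * cf_theta \<theta> (Suc k)"
    unfolding nq ip cf_theta_def by (simp add: algebra_simps)
  also have "\<dots> = (-1) ^ k * (of_int u * eta k - of_int v * eta (Suc k))"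
    by (simp add: cf_theta_eta algebra_simps)
  finally have d: "\<bar>of_int u * eta k - of_int v * eta (Suc k)\<bar> < eta k"
    using ni by (simp add: abs_mult)
  have q1: "q k \<ge> 1" "q (Suc k) \<ge> 1" using q_pos by auto
  have e1: "eta k > 0" "eta (Suc k) > 0" using eta_pos by auto
  consider "v = 0" | "u = 0" "v \<noteq> 0" | "u \<ge> 1" "v \<ge> 1" | "u \<le> -1" "v \<le> -1" | "u \<ge> 1" "v \<le> -1" | "u \<le> -1" "v \<ge> 1"
    by linarith
  then show ?thesis
  proof cases
    case 1
    then have "\<bar>of_int u\<bar> * eta k < 1 * eta k" using d e1 by (simp add: abs_mult)
    then have "\<bar>real_of_int u\<bar> < 1" using e1 by (simp only: mult_less_cancel_right)
    then have "u = 0" by linarith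
    then show ?thesis using 1 nq by simp
  next
    case 2
    have "1 * q (Suc k) \<le> \<bar>v\<bar> * q (Suc k)" using 2 q1 by (intro mult_right_mono) auto
    then show ?thesis using n nq 2 q1 by (simp add: abs_mult)
  next
    case 3
    have "1 * q (Suc k) \<le> v * q (Suc k)" "0 \<le> u * q k" using 3 q1 by (auto intro!: mult_right_mono)
    then show ?thesis using n nq by linarith
  next
    case 4
    have "1 * q (Suc k) \<le> (-v) * q (Suc k)" "0 \<le> (-u) * q k" using 4 q1 by (auto intro!: mult_right_mono mult_nonneg_nonneg simp del: mult_minus_left)
    then show ?thesis using n nq by simp
  next
    case 5
    have "1 * eta k \<le> of_int u * eta k" using 5 e1 by (intro mult_right_mono) auto
    moreover have "0 \<le> of_int (-v) * eta (Suc k)" using 5 e1 by (intro mult_nonneg_nonneg) auto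
    ultimately show ?thesis using d by simp
  next
    case 6
    have "1 * eta k \<le> of_int (-u) * eta k" using 6 e1 by (intro mult_right_mono) auto
    moreover have "0 \<le> of_int v * eta (Suc k)" using 6 e1 by (intro mult_nonneg_nonneg) auto
    ultimately show ?thesis using d by simp
  qed
qed

end

section \<open>Ostrowski digits and hitting times\<close>

lemma sgn_abs_oriented:
  fixes \<delta> x :: real
  assumes "\<delta> = (-1) ^ k * x" "x > 0"
  shows "sgn \<delta> = (-1) ^ k" "\<bar>\<delta>\<bar> = x"
  using assms by (cases "even k"; simp)+

text \<open>\<open>H\<close> says that an integer lies strictly between \<open>x\<close> and
  \<open>x + \<delta>\<close>; as \<open>\<bar>\<delta>\<bar> < 1\<close>, the floor moves by at
  most one.\<close>

lemma floor_add_diff: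
  fixes x \<delta> :: real
  assumes "0 < \<bar>\<delta>\<bar>" "\<bar>\<delta>\<bar> < 1" and x: "x \<notin> \<int>" "x + \<delta> \<notin> \<int>"
  defines "H \<equiv> \<exists>i::int. - \<bar>\<delta>\<bar> < sgn \<delta> * (x - of_int i) \<and> sgn \<delta> * (x - of_int i) < 0"
  shows "\<lfloor>x + \<delta>\<rfloor> - \<lfloor>x\<rfloor> = (if H then (if \<delta> > 0 then 1 else -1) else 0)"
proof (cases "\<delta> > 0")
  case True
  have H: "H \<longleftrightarrow> (\<exists>i::int. x < of_int i \<and> of_int i < x + \<delta>)" using True by (auto simp: H_def algebra_simps)
  have lt: "of_int \<lfloor>x + \<delta>\<rfloor> < x + \<delta>" using x(2) by (metis Ints_of_int of_int_floor_le order_less_le)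
  have *: "\<lfloor>x + \<delta>\<rfloor> \<le> \<lfloor>x\<rfloor> + 1" "\<lfloor>x\<rfloor> \<le> \<lfloor>x + \<delta>\<rfloor>" using assms True by linarith+
  show ?thesis
  proof (cases H)
    case h: True
    then obtain i :: int where "x < of_int i" "of_int i < x + \<delta>" using H by blast
    then have "\<lfloor>x\<rfloor> < i" "i \<le> \<lfloor>x + \<delta>\<rfloor>" by linarith+
    then show ?thesis using h True * by simp
  next
    case False
    then have "\<not> x < of_int \<lfloor>x + \<delta>\<rfloor>" using H lt by blast
    then have "\<lfloor>x + \<delta>\<rfloor> \<le> \<lfloor>x\<rfloor>" by linarith
    then show ?thesis using False * by simp
  qed
next
  case nT: False
  then have neg: "\<delta> < 0" using assms by simp
  have H: "H \<longleftrightarrow> (\<exists>i::int. x + \<delta> < of_int i \<and> of_int i < x)" using neg by (auto simp: H_def algebra_simps)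
  have lt: "of_int \<lfloor>x\<rfloor> < x" using x(1) by (metis Ints_of_int of_int_floor_le order_less_le)
  have *: "\<lfloor>x\<rfloor> \<le> \<lfloor>x + \<delta>\<rfloor> + 1" "\<lfloor>x + \<delta>\<rfloor> \<le> \<lfloor>x\<rfloor>" using assms neg by linarith+
  show ?thesis
  proof (cases H)
    case h: True
    then obtain i :: int where "x + \<delta> < of_int i" "of_int i < x" using H by blast
    then have "\<lfloor>x + \<delta>\<rfloor> < i" "i \<le> \<lfloor>x\<rfloor>" by linarith+
    then show ?thesis using h nT * by simp
  next
    case False
    then have "\<not> x + \<delta> < of_int \<lfloor>x\<rfloor>" using H lt by blast
    then have "\<lfloor>x\<rfloor> \<le> \<lfloor>x + \<delta>\<rfloor>" by linarith
    then show ?thesis using False * by simp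
  qed
qed

text \<open>Only rules on single and neighbouring digits are kept, so the locale also covers
  \<open>\<beta>\<close> and \<open>\<beta>'\<close>, whose tails alternate between 0 and full
  digits.\<close>

locale ostrowski_digits = irrational_cf +
  fixes d :: "nat \<Rightarrow> int"
  assumes d_1: "d 1 \<le> a 1 - 1"
    and d_nonneg: "k \<ge> 1 \<Longrightarrow> 0 \<le> d k"
    and d_le: "k \<ge> 1 \<Longrightarrow> d k \<le> a k"
    and d_rule: "k \<ge> 1 \<Longrightarrow> d (Suc k) = a (Suc k) \<Longrightarrow> d k = 0"
begin

section \<open>Partial digit sums and their tails\<close>

abbreviation "t \<equiv> digit_t \<theta> d"
abbreviation "r \<equiv> digit_r \<theta> d"

text \<open>\<open>P\<close> is to \<open>t\<close> what \<open>p\<close> is to \<open>q\<close>: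
  \<open>S k = t k * \<theta> - P k\<close>.\<close>

definition P :: "nat \<Rightarrow> int" where "P k = (\<Sum>j<k. d (Suc j) * p j)"
definition S :: "nat \<Rightarrow> real" where "S k = (\<Sum>j<k. of_int (d (Suc j)) * cf_theta \<theta> j)"
text \<open>The digit tail \<open>\<Sum>\<^sub>k\<^sub><\<^sub>j\<^sub>\<le>\<^sub>J d\<^sub>j \<theta>\<^sub>j\<^sub>-\<^sub>1\<close>, oriented by the sign of \<open>\<theta>\<^sub>k\<close>.\<close>

definition sigma :: "nat \<Rightarrow> nat \<Rightarrow> real" where "sigma k J = (-1) ^ k * (S J - S k)"

lemma t_0: "t 0 = 0" by (simp add: digit_t_def)
lemma t_Suc: "t (Suc k) = t k + d (Suc k) * q k" by (simp add: digit_t_def)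
lemma r_Suc: "r (Suc k) = q (Suc k) - t k - d (Suc k) * q k" by (simp add: digit_r_def t_Suc)
lemma r_plus_t: "r k + t k = q k" by (simp add: digit_r_def)

lemma S_Suc: "S (Suc k) = S k + of_int (d (Suc k)) * cf_theta \<theta> k" by (simp add: S_def)

lemma S_eq: "S k = of_int (t k) * \<theta> - of_int (P k)"
  by (induction k) (simp_all add: S_def P_def t_0 t_Suc cf_theta_def algebra_simps)

lemma t_nonneg: "0 \<le> t k"
proof (induction k)
  case (Suc k)
  then show ?case using d_nonneg[of "Suc k"] q_pos[of k] by (simp add: t_Suc)
qed (simp add: t_0)

text \<open>The induction carries two indices: a full digit forces the preceding digit to vanish, so
  that the bound two levels down is the one needed.\<close>

lemma t_less_q: "t k < q k"
proof -
  have "t k < q k \<and> t (Suc k) < q (Suc k)"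
  proof (induction k)
    case 0
    then show ?case using d_1 by (simp add: t_Suc t_0)
  next
    case (Suc k)
    show ?case
    proof (cases "d (Suc (Suc k)) = a (Suc (Suc k))")
      case True
      then have "d (Suc k) = 0" by (intro d_rule) auto
      then show ?thesis using Suc True by (simp add: t_Suc q_Suc_Suc)
    next
      case False
      then have "d (Suc (Suc k)) \<le> a (Suc (Suc k)) - 1" using d_le[of "Suc (Suc k)"] by simp
      then have "d (Suc (Suc k)) * q (Suc k) \<le> (a (Suc (Suc k)) - 1) * q (Suc k)"
        using q_pos[of "Suc k"] by (intro mult_right_mono) auto
      then show ?thesis using Suc q_pos[of k] by (simp add: t_Suc[of "Suc k"] q_Suc_Suc algebra_simps)
    qed
  qed
  then show ?thesis by simp
qed

lemma r_ge_1: "r k \<ge> 1" using t_less_q[of k] by (simp add: digit_r_def)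
lemma r_le_q: "r k \<le> q k" using t_nonneg[of k] by (simp add: digit_r_def)

lemma t_mult_theta: "of_int (t J) * \<theta> = of_int (t k) * \<theta> + (S J - S k) + of_int (P J - P k)"
  by (simp add: S_eq)

lemma sigma_Suc: "sigma k J = of_int (d (Suc k)) * eta k - sigma (Suc k) J"
  by (simp add: sigma_def S_Suc cf_theta_eta algebra_simps minus_one_power_mult_self)

text \<open>Backward induction from the empty tail at \<open>J\<close>. By \<open>sigma_Suc\<close>
  each bound yields the other one level down; even with a full digit the upper bound at
  \<open>Suc k\<close> is only \<open>eta k\<close>, by the recurrence of
  \<open>eta\<close>.\<close>

lemma sigma_bounds:
  "k \<le> J \<Longrightarrow> - eta k < sigma k J \<and> sigma k J < of_int (d (Suc k)) * eta k + eta (Suc k)"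
proof (induction rule: inc_induct)
  case base
  have "0 \<le> of_int (d (Suc J)) * eta J" using d_nonneg[of "Suc J"] eta_pos[of J] by simp
  then show ?case using eta_pos[of J] eta_pos[of "Suc J"] by (simp add: sigma_def)
next
  case (step k)
  have "of_int (d (Suc (Suc k))) * eta (Suc k) \<le> of_int (a (Suc (Suc k))) * eta (Suc k)"
    using d_le[of "Suc (Suc k)"] eta_pos[of "Suc k"] by (intro mult_right_mono) auto
  moreover have "0 \<le> of_int (d (Suc k)) * eta k" using d_nonneg[of "Suc k"] eta_pos[of k] by simp
  ultimately show ?case using step.IH sigma_Suc[of k J] eta_Suc_Suc[of k] by simp
qed

lemma sigma_gt: "k \<le> J \<Longrightarrow> - eta k < sigma k J" using sigma_bounds by blast

lemma sigma_Suc_less: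
  assumes "Suc k \<le> J"
  shows "sigma (Suc k) J < eta k - of_int (a (Suc (Suc k)) - d (Suc (Suc k))) * eta (Suc k)"
  using sigma_bounds[OF assms] eta_Suc_Suc[of k] by (simp add: algebra_simps)

lemma sigma_Suc_less_1:
  assumes "Suc k \<le> J" "d (Suc (Suc k)) < a (Suc (Suc k))"
  shows "sigma (Suc k) J < eta k - eta (Suc k)"
proof -
  have "1 * eta (Suc k) \<le> of_int (a (Suc (Suc k)) - d (Suc (Suc k))) * eta (Suc k)"
    using assms(2) eta_pos[of "Suc k"] by (intro mult_right_mono) auto
  then show ?thesis using sigma_Suc_less[OF assms(1)] by simp
qed

text \<open>Room for a second return of the orbit, needed in \<open>good_rq_q\<close>. In the second
  alternative the digit after the full one cannot be full, so the tail behind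
  \<open>d (Suc (Suc k))\<close> is large and enters with a minus sign, replacing the missing
  unit.\<close>

lemma sigma_Suc_less_2:
  assumes J: "k + 4 \<le> J"
    and c: "d (Suc (Suc k)) + 2 \<le> a (Suc (Suc k)) \<or>
      d (Suc (Suc k)) + 1 = a (Suc (Suc k)) \<and> d (Suc (Suc (Suc k))) = a (Suc (Suc (Suc k)))"
  shows "sigma (Suc k) J < eta k - 2 * eta (Suc k)"
  using c
proof
  assume "d (Suc (Suc k)) + 2 \<le> a (Suc (Suc k))"
  then have "2 * eta (Suc k) \<le> of_int (a (Suc (Suc k)) - d (Suc (Suc k))) * eta (Suc k)"
    using eta_pos[of "Suc k"] by (intro mult_right_mono) auto
  then show ?thesis using sigma_Suc_less[of k J] J by simp
next
  let ?j = "Suc (Suc k)"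
  assume *: "d (Suc (Suc k)) + 1 = a (Suc (Suc k)) \<and> d (Suc ?j) = a (Suc ?j)"
  have "d (Suc (Suc ?j)) \<noteq> a (Suc (Suc ?j))"
    using d_rule[of "Suc ?j"] * a_ge_1[of "Suc ?j"] by auto
  then have "d (Suc (Suc ?j)) < a (Suc (Suc ?j))" using d_le[of "Suc (Suc ?j)"] by simp
  then have "sigma (Suc ?j) J < eta ?j - eta (Suc ?j)" using J by (intro sigma_Suc_less_1) auto
  then have s: "sigma ?j J > eta (Suc k) - eta ?j"
    using sigma_Suc[of ?j J] eta_Suc_Suc[of "Suc k"] * by simp
  have "real_of_int (d ?j) = of_int (a ?j) - 1" using * by linarith
  then have "of_int (d ?j) * eta (Suc k) = of_int (a ?j) * eta (Suc k) - eta (Suc k)"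
    by (simp add: left_diff_distrib)
  then show ?thesis using s sigma_Suc[of "Suc k" J] eta_Suc_Suc[of k] by simp
qed

end

text \<open>
  By \<open>Y_eventually\<close>, every \<open>Y m\<close> is computed from a finite digit string, hence from floors of
  positive multiples of \<open>\<theta>\<close>, which are never integers. This treats intercepts inside and outside
  \<open>\<int>\<theta> + \<int>\<close> alike and makes all inequalities below strict.
\<close>

locale sturmian_number = ostrowski_digits +
  fixes b :: int and \<xi> :: real and Y :: "nat \<Rightarrow> int"
  assumes b: "b \<ge> 2"
    and Y_summable: "summable (\<lambda>n. of_int (Y (Suc n)) / real_of_int b ^ Suc n)"
    and xi_eq: "\<xi> = (of_int b - 1) * (\<Sum>n. of_int (Y (Suc (Suc n)) - Y (Suc n)) / of_int b ^ Suc n)"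
    and Y_eventually: "m \<ge> 1 \<Longrightarrow>
      \<exists>J0. \<forall>J\<ge>J0. Y m = \<lfloor>(real m + of_int (digit_t \<theta> d J)) * \<theta>\<rfloor> - (\<Sum>j<J. d (Suc j) * cf_p \<theta> j)"
begin

section \<open>Hitting times for the four families of approximations\<close>

abbreviation good :: "int \<Rightarrow> int \<Rightarrow> bool" where
  "good e e' \<equiv> good_approx (of_int b) \<xi> (of_int e) (of_int e')"

text \<open>A hit at time \<open>m\<close> is an integer between the orbit point and its translate
  by \<open>\<delta>\<close>. The truncation \<open>J\<close> at which \<open>Y\<close> is computed
  depends on \<open>m\<close>, hence the hypotheses for all \<open>J \<ge> Jmin\<close>.\<close>

lemma good_of_hits:
  fixes U V M p0 :: int and \<delta> :: real and Jmin :: nat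
  assumes U: "U \<ge> 0" and V: "V \<ge> 1" and M: "M \<ge> 1" and delta: "\<delta> = of_int V * \<theta> - of_int p0"
    and d1: "0 < \<bar>\<delta>\<bar>" "\<bar>\<delta>\<bar> < 1"
    and hit: "\<And>J. J \<ge> Jmin \<Longrightarrow> \<exists>i::int. - \<bar>\<delta>\<bar> < sgn \<delta> * (of_int (U + M + t J) * \<theta> - of_int i) \<and>
       sgn \<delta> * (of_int (U + M + t J) * \<theta> - of_int i) < 0"
    and nohit: "\<And>J m i. J \<ge> Jmin \<Longrightarrow> U < m \<Longrightarrow> m < U + M \<Longrightarrow>
       - \<bar>\<delta>\<bar> < sgn \<delta> * (of_int (m + t J) * \<theta> - of_int i) \<Longrightarrow>
       sgn \<delta> * (of_int (m + t J) * \<theta> - of_int i) < 0 \<Longrightarrow> False"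
  shows "good (U + V) M"
proof -
  define s :: int where "s = (if \<delta> > 0 then 1 else -1)"
  define H where "H J m \<longleftrightarrow> (\<exists>i::int. - \<bar>\<delta>\<bar> < sgn \<delta> * (of_int (int m + t J) * \<theta> - of_int i) \<and>
       sgn \<delta> * (of_int (int m + t J) * \<theta> - of_int i) < 0)" for J and m :: nat
  have key: "\<exists>J\<ge>Jmin. Y (m + nat V) - Y m - p0 = (if H J m then s else 0)" if m: "m \<ge> 1" for m
  proof -
    obtain J0 where J0: "\<forall>J\<ge>J0. Y m = \<lfloor>(real m + of_int (t J)) * \<theta>\<rfloor> - P J"
      using Y_eventually[OF m] unfolding P_def by blast
    obtain J2 where J2: "\<forall>J\<ge>J2. Y (m + nat V) = \<lfloor>(real (m + nat V) + of_int (t J)) * \<theta>\<rfloor> - P J"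
      using Y_eventually[of "m + nat V"] m unfolding P_def by auto
    define J where "J = max Jmin (max J0 J2)"
    define x where "x = of_int (int m + t J) * \<theta>"
    have nz: "of_int n * \<theta> \<notin> \<int>" if "n \<ge> 1" for n :: int
      using int_mult_theta_eq[of n] that by (auto elim!: Ints_cases)
    have Vr: "real (nat V) = of_int V" using V by simp
    have "Y m = \<lfloor>x\<rfloor> - P J" using J0 by (simp add: J_def x_def)
    moreover have "Y (m + nat V) = \<lfloor>x + \<delta>\<rfloor> + p0 - P J"
    proof -
      have "(real (m + nat V) + of_int (t J)) * \<theta> = x + \<delta> + of_int p0"
        using Vr by (simp add: x_def delta algebra_simps)
      moreover have "Y (m + nat V) = \<lfloor>(real (m + nat V) + of_int (t J)) * \<theta>\<rfloor> - P J"
        using J2 by (simp add: J_def)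
      ultimately show ?thesis by simp
    qed
    moreover have "\<lfloor>x + \<delta>\<rfloor> - \<lfloor>x\<rfloor> = (if H J m then s else 0)"
      unfolding H_def s_def x_def[symmetric]
    proof (rule floor_add_diff[OF d1])
      show "x \<notin> \<int>" unfolding x_def using t_nonneg[of J] m by (intro nz) auto
      have "of_int (int m + t J + V) * \<theta> \<notin> \<int>" using t_nonneg[of J] m V by (intro nz) auto
      moreover have "x + \<delta> = of_int (int m + t J + V) * \<theta> - of_int p0"
        by (simp add: x_def delta algebra_simps)
      ultimately show "x + \<delta> \<notin> \<int>" by (metis Ints_add Ints_of_int diff_add_cancel)
    qed
    ultimately have "Y (m + nat V) - Y m - p0 = (if H J m then s else 0)" by simp
    then show ?thesis by (intro exI[of _ J]) (simp add: J_def)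
  qed
  have "good_approx (of_int b) \<xi> (real (nat U + nat V)) (real (nat M))"
  proof (rule good_approx_of_first_hit[OF b Y_summable xi_eq, where p = p0 and s = s])
    show "nat V \<ge> 1" "nat M \<ge> 1" using V M by auto
    show "\<bar>s\<bar> = 1" by (simp add: s_def)
    show "Y (m + nat V) - Y m - p0 \<in> {0, s}" if "m > nat U" for m
      using key[of m] that by (auto split: if_splits)
    show "Y (m + nat V) - Y m = p0" if m: "m > nat U" "m < nat U + nat M" for m
    proof -
      obtain J where J: "J \<ge> Jmin" "Y (m + nat V) - Y m - p0 = (if H J m then s else 0)"
        using key[of m] m by auto
      have "U < int m" "int m < U + M" using m U M by linarith+
      then have "\<not> H J m" unfolding H_def using nohit[OF J(1), of "int m"] by blast
      then show ?thesis using J by simp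
    qed
    show "Y (nat U + nat M + nat V) - Y (nat U + nat M) = p0 + s"
    proof -
      obtain J where J: "J \<ge> Jmin" "Y (nat U + nat M + nat V) - Y (nat U + nat M) - p0
          = (if H J (nat U + nat M) then s else 0)"
        using key[of "nat U + nat M"] M by (auto simp: Suc_le_eq)
      have "H J (nat U + nat M)" unfolding H_def using hit[OF J(1)] U M by simp
      then show ?thesis using J by simp
    qed
  qed
  then show ?thesis using U V M by simp
qed

text \<open>Since \<open>r (Suc k) + t (Suc k) = q (Suc k)\<close>, the time and the first digits
  together give \<open>i + 1\<close> copies of \<open>cf_theta \<theta> (Suc k)\<close>; only the
  tail remains.\<close>

lemma value_at_return:
  "(-1) ^ k * (of_int (r (Suc k) + i * q (Suc k) + t J) * \<theta> - of_int ((i + 1) * p (Suc k) + (P J - P (Suc k))))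
    = - (of_int i + 1) * eta (Suc k) - sigma (Suc k) J"
proof -
  have "of_int (r (Suc k) + i * q (Suc k) + t J) * \<theta> - of_int ((i + 1) * p (Suc k) + (P J - P (Suc k)))
     = (of_int i + 1) * cf_theta \<theta> (Suc k) + (S J - S (Suc k))"
    using t_mult_theta[of J "Suc k"] by (simp add: digit_r_def cf_theta_def algebra_simps)
  then have "(-1) ^ k * (of_int (r (Suc k) + i * q (Suc k) + t J) * \<theta> - of_int ((i + 1) * p (Suc k) + (P J - P (Suc k))))
     = (of_int i + 1) * ((-1) ^ k * cf_theta \<theta> (Suc k)) + (-1) ^ k * (S J - S (Suc k))"
    by (simp only: distrib_left mult.left_commute)
  then show ?thesis unfolding cf_theta_Suc_eta by (simp add: sigma_def algebra_simps)
qed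

text \<open>Two points in one interval of length \<open>eta k\<close> differ by less than
  \<open>eta k\<close>, which \<open>best_approximation\<close> forbids for time gaps below
  \<open>q (Suc k)\<close>.\<close>

lemma no_close_hits:
  assumes "- eta k < (-1) ^ k * (of_int (m + t J) * \<theta> - of_int i)" "(-1) ^ k * (of_int (m + t J) * \<theta> - of_int i) < 0"
    and "- eta k < (-1) ^ k * (of_int (m' + t J) * \<theta> - of_int i')" "(-1) ^ k * (of_int (m' + t J) * \<theta> - of_int i') < 0"
    and "m < m'" "m' - m < q (Suc k)"
  shows False
proof -
  let ?x = "(-1) ^ k * (of_int (m + t J) * \<theta> - of_int i)"
  let ?y = "(-1) ^ k * (of_int (m' + t J) * \<theta> - of_int i')"
  have "\<bar>?y - ?x\<bar> < eta k" using assms by linarith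
  also have "?y - ?x = (-1) ^ k * (of_int (m' - m) * \<theta> - of_int (i' - i))" by (simp add: algebra_simps)
  finally have "\<bar>of_int (m' - m) * \<theta> - of_int (i' - i)\<bar> < eta k" by (simp add: abs_mult)
  then have "m' - m = 0" by (rule best_approximation[rotated]) (use assms(5,6) in simp)
  then show False using assms(5) by simp
qed

text \<open>\<open>U = 0\<close>, \<open>V = q k\<close>. A digit that is not full keeps the tail
  small enough for a hit at \<open>r (Suc k)\<close>; as \<open>r (Suc k) \<le> q (Suc k)\<close>,
  \<open>no_close_hits\<close> excludes an earlier one.\<close>

lemma good_q_r:
  assumes c: "d (Suc (Suc k)) < a (Suc (Suc k))"
  shows "good (q k) (r (Suc k))"
proof -
  have sgn: "sgn (cf_theta \<theta> k) = (-1) ^ k" "\<bar>cf_theta \<theta> k\<bar> = eta k"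
    using sgn_abs_oriented[OF cf_theta_eta eta_pos] by auto
  have hit: "\<exists>i::int. - eta k < (-1) ^ k * (of_int (r (Suc k) + t J) * \<theta> - of_int i) \<and>
       (-1) ^ k * (of_int (r (Suc k) + t J) * \<theta> - of_int i) < 0" if J: "J \<ge> Suc k" for J
    using value_at_return[of k 0 J] sigma_gt[OF J] sigma_Suc_less_1[OF J c]
    by (intro exI[of _ "p (Suc k) + (P J - P (Suc k))"]) simp
  have "good (0 + q k) (r (Suc k))"
  proof (rule good_of_hits[where Jmin = "Suc k"])
    show "cf_theta \<theta> k = of_int (q k) * \<theta> - of_int (p k)" by (simp add: cf_theta_def)
    show "0 < \<bar>cf_theta \<theta> k\<bar>" "\<bar>cf_theta \<theta> k\<bar> < 1" unfolding sgn by (rule eta_pos eta_less_1)+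
    fix J assume J: "J \<ge> Suc k"
    show "\<exists>i::int. - \<bar>cf_theta \<theta> k\<bar> < sgn (cf_theta \<theta> k) * (of_int (0 + r (Suc k) + t J) * \<theta> - of_int i) \<and>
       sgn (cf_theta \<theta> k) * (of_int (0 + r (Suc k) + t J) * \<theta> - of_int i) < 0"
      unfolding sgn using hit[OF J] by simp
    fix m i assume m: "0 < m" "m < 0 + r (Suc k)"
      and h: "- \<bar>cf_theta \<theta> k\<bar> < sgn (cf_theta \<theta> k) * (of_int (m + t J) * \<theta> - of_int i)"
       "sgn (cf_theta \<theta> k) * (of_int (m + t J) * \<theta> - of_int i) < 0"
    show False
    proof -
      obtain i' :: int where "- eta k < (-1) ^ k * (of_int (r (Suc k) + t J) * \<theta> - of_int i')"
        "(-1) ^ k * (of_int (r (Suc k) + t J) * \<theta> - of_int i') < 0" using hit[OF J] by blast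
      from no_close_hits[OF h[unfolded sgn] this] show False using m r_le_q[of "Suc k"] by simp
    qed
  qed (use q_pos r_ge_1 in auto)
  then show ?thesis by simp
qed

text \<open>\<open>U = r (Suc k)\<close>, \<open>V = q k\<close>: the next return comes
  \<open>q (Suc k)\<close> later and costs another \<open>eta (Suc k)\<close>, for which the
  hypothesis leaves room.\<close>

lemma good_rq_q:
  assumes c: "d (Suc (Suc k)) + 2 \<le> a (Suc (Suc k)) \<or>
      d (Suc (Suc k)) + 1 = a (Suc (Suc k)) \<and> d (Suc (Suc (Suc k))) = a (Suc (Suc (Suc k)))"
  shows "good (r (Suc k) + q k) (q (Suc k))"
proof -
  have sgn: "sgn (cf_theta \<theta> k) = (-1) ^ k" "\<bar>cf_theta \<theta> k\<bar> = eta k"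
    using sgn_abs_oriented[OF cf_theta_eta eta_pos] by auto
  have hit: "\<exists>i::int. - eta k < (-1) ^ k * (of_int (r (Suc k) + q (Suc k) + t J) * \<theta> - of_int i) \<and>
       (-1) ^ k * (of_int (r (Suc k) + q (Suc k) + t J) * \<theta> - of_int i) < 0" if J: "J \<ge> k + 4" for J
    using value_at_return[of k 1 J] sigma_gt[of "Suc k" J] sigma_Suc_less_2[OF J c] J eta_pos[of "Suc k"]
    by (intro exI[of _ "2 * p (Suc k) + (P J - P (Suc k))"]) simp
  show ?thesis
  proof (rule good_of_hits[where Jmin = "k + 4"])
    show "cf_theta \<theta> k = of_int (q k) * \<theta> - of_int (p k)" by (simp add: cf_theta_def)
    show "0 < \<bar>cf_theta \<theta> k\<bar>" "\<bar>cf_theta \<theta> k\<bar> < 1" unfolding sgn by (rule eta_pos eta_less_1)+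
    fix J assume J: "J \<ge> k + 4"
    show "\<exists>i::int. - \<bar>cf_theta \<theta> k\<bar> < sgn (cf_theta \<theta> k) * (of_int (r (Suc k) + q (Suc k) + t J) * \<theta> - of_int i) \<and>
       sgn (cf_theta \<theta> k) * (of_int (r (Suc k) + q (Suc k) + t J) * \<theta> - of_int i) < 0"
      unfolding sgn using hit[OF J] .
    fix m i assume m: "r (Suc k) < m" "m < r (Suc k) + q (Suc k)"
      and h: "- \<bar>cf_theta \<theta> k\<bar> < sgn (cf_theta \<theta> k) * (of_int (m + t J) * \<theta> - of_int i)"
       "sgn (cf_theta \<theta> k) * (of_int (m + t J) * \<theta> - of_int i) < 0"
    show False
    proof -
      obtain i' :: int where "- eta k < (-1) ^ k * (of_int (r (Suc k) + q (Suc k) + t J) * \<theta> - of_int i')"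
        "(-1) ^ k * (of_int (r (Suc k) + q (Suc k) + t J) * \<theta> - of_int i') < 0" using hit[OF J] by blast
      from no_close_hits[OF h[unfolded sgn] this] show False using m by simp
    qed
  qed (use q_pos r_ge_1[of "Suc k"] in auto)
qed

text \<open>Adding \<open>q k\<close> to \<open>n\<close> raises \<open>z\<close> by
  \<open>eta k\<close>. If \<open>z \<le> 0\<close>, at most \<open>d (Suc k)\<close> such steps
  bring it so close to 0 that \<open>best_approximation\<close> applies: at level
  \<open>Suc k\<close> if all steps are needed, otherwise at level \<open>k\<close>.\<close>

lemma no_negative_hit:
  fixes n i :: int
  assumes n: "1 \<le> n" "n < q (Suc k) - (d (Suc k) - 1) * q k"
    and z: "z = (-1) ^ k * (of_int n * \<theta> - of_int i)"
    and lo: "- of_int (d (Suc k)) * eta k - eta (Suc k) < z"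
  shows "z > 0"
proof (rule ccontr)
  assume "\<not> z > 0"
  then have z0: "z \<le> 0" by simp
  let ?b = "d (Suc k)"
  have b0: "?b \<ge> 0" using d_nonneg by simp
  have q1: "q k \<ge> 1" by (rule q_pos)
  have e: "eta k > 0" by (rule eta_pos)
  have shift: "z + of_int j * eta k = (-1) ^ k * (of_int (n + j * q k) * \<theta> - of_int (i + j * p k))" for j
    by (simp add: z eta_def cf_theta_def algebra_simps)
  show False
  proof (cases "z \<le> - of_int ?b * eta k")
    case True
    then have "\<bar>z + of_int ?b * eta k\<bar> < eta (Suc k)" using lo by simp
    then have "\<bar>of_int (n + ?b * q k) * \<theta> - of_int (i + ?b * p k)\<bar> < eta (Suc k)"
      unfolding shift by (simp add: abs_mult)
    moreover have "\<bar>n + ?b * q k\<bar> < q (Suc (Suc k))"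
      using n b0 q1 q_Suc_Suc_ge[of k] by (simp add: algebra_simps)
    ultimately have "n + ?b * q k = 0" by (rule best_approximation[rotated])
    then show False using n b0 q1 by (smt (verit) mult_nonneg_nonneg)
  next
    case False
    define j where "j = \<lfloor>- z / eta k\<rfloor>"
    have j: "of_int j \<le> - z / eta k" "- z / eta k < of_int j + 1" unfolding j_def by linarith+
    have "- z / eta k < of_int ?b" using False e by (simp add: field_simps)
    then have jb: "j \<le> ?b - 1" using j by linarith
    have "0 \<le> - z / eta k" using z0 e by (intro divide_nonneg_pos) auto
    then have j0: "j \<ge> 0" using j by linarith
    have "\<bar>z + of_int j * eta k\<bar> < eta k" using j e by (simp add: field_simps)
    then have close: "\<bar>of_int (n + j * q k) * \<theta> - of_int (i + j * p k)\<bar> < eta k"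
      unfolding shift by (simp add: abs_mult)
    have "j * q k \<le> (?b - 1) * q k" using jb q1 by (intro mult_right_mono) auto
    moreover have "0 \<le> j * q k" using j0 q1 by simp
    ultimately have "\<bar>n + j * q k\<bar> < q (Suc k)" using n by linarith
    then have "n + j * q k = 0" using close by (rule best_approximation)
    then show False using n j0 q1 by (smt (verit) mult_nonneg_nonneg)
  qed
qed

lemma value_shifted:
  "(-1) ^ k * (of_int (m + t J) * \<theta> - of_int i)
    = (-1) ^ k * (of_int (m + t k) * \<theta> - of_int (i - (P J - P k))) + of_int (d (Suc k)) * eta k - sigma (Suc k) J"
proof -
  have "of_int (m + t J) * \<theta> - of_int i = (of_int (m + t k) * \<theta> - of_int (i - (P J - P k))) + (S J - S k)"
    using t_mult_theta[of J k] by (simp add: algebra_simps)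
  then have "(-1) ^ k * (of_int (m + t J) * \<theta> - of_int i)
    = (-1) ^ k * (of_int (m + t k) * \<theta> - of_int (i - (P J - P k))) + sigma k J"
    by (simp only: sigma_def distrib_left)
  then show ?thesis using sigma_Suc[of k J] by simp
qed

lemma value_last:
  "(-1) ^ k * (of_int (q (Suc k) - (j - 1) * q k) * \<theta> - of_int (p (Suc k) - (j - 1) * p k))
    = - eta (Suc k) - (of_int j - 1) * eta k"
  by (simp add: eta_def cf_theta_def algebra_simps)

text \<open>\<open>U = 0\<close>, with \<open>V\<close> the denominator of an intermediate fraction,
  or \<open>q k\<close> if the digit is full. The hit satisfies
  \<open>m + t (Suc k) = V + q (Suc k)\<close>. A positive digit prevents the next one from being
  full, which bounds the tail.\<close>

lemma good_rt_rq:
  assumes b1: "d (Suc (Suc k)) \<ge> 1"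
  shows "good (r (Suc (Suc k)) + t (Suc k)) (r (Suc (Suc k)) + q (Suc k))"
proof -
  let ?K = "Suc k"
  let ?b = "d (Suc ?K)"
  define V where "V = (a (Suc ?K) - ?b) * q ?K + q k"
  define \<delta> where "\<delta> = of_int V * \<theta> - of_int ((a (Suc ?K) - ?b) * p ?K + p k)"
  define D where "D = of_int ?b * eta ?K + eta (Suc ?K)"
  have Dpos: "D > 0" using b1 eta_pos[of ?K] eta_pos[of "Suc ?K"] by (simp add: D_def add_pos_pos)
  have "\<delta> = (-1) ^ k * (eta k - of_int (a (Suc ?K) - ?b) * eta ?K)"
    by (simp add: \<delta>_def V_def eta_def cf_theta_def algebra_simps minus_one_power_mult_self)
  then have delta: "\<delta> = (-1) ^ k * D" by (simp add: D_def eta_Suc_Suc[of k] algebra_simps)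
  note sgn = sgn_abs_oriented[OF delta Dpos]
  have c0: "a (Suc ?K) - ?b \<ge> 0" using d_le[of "Suc ?K"] by simp
  have D1: "D < 1"
  proof -
    have "0 \<le> of_int (a (Suc ?K) - ?b) * eta ?K" using c0 eta_pos[of ?K] by (intro mult_nonneg_nonneg) auto
    then have "D \<le> eta k" by (simp add: D_def eta_Suc_Suc[of k] algebra_simps)
    then show ?thesis using eta_less_1[of k] by simp
  qed
  have dlt: "d (Suc (Suc ?K)) < a (Suc (Suc ?K))"
    using d_rule[of "Suc ?K"] b1 d_le[of "Suc (Suc ?K)"] by (auto simp: order_less_le)
  have rt: "r (Suc ?K) + t ?K = q (Suc ?K) - ?b * q ?K" by (simp add: r_Suc)
  have Vrt: "V = r (Suc ?K) + t ?K" unfolding rt by (simp add: V_def q_Suc_Suc algebra_simps)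
  have bq: "?b * q ?K \<ge> 1 * q ?K" using b1 q_pos[of ?K] by (intro mult_right_mono) auto
  have "good (0 + V) (r (Suc ?K) + q ?K)"
  proof (rule good_of_hits[where Jmin = "Suc ?K"])
    show "\<delta> = of_int V * \<theta> - of_int ((a (Suc ?K) - ?b) * p ?K + p k)" by (rule \<delta>_def)
    show "0 < \<bar>\<delta>\<bar>" "\<bar>\<delta>\<bar> < 1" unfolding sgn by fact+
    show "V \<ge> 1" unfolding Vrt using r_ge_1[of "Suc ?K"] t_nonneg[of ?K] by simp
    show "r (Suc ?K) + q ?K \<ge> 1" using r_ge_1[of "Suc ?K"] q_pos[of ?K] by simp
    fix J assume J: "J \<ge> Suc ?K"
    note sg = sigma_gt[OF J] sigma_Suc_less_1[OF J dlt]
    have val: "(-1) ^ k * (of_int (m + t J) * \<theta> - of_int i) = - ((-1) ^ ?K * (of_int (m + t ?K) * \<theta> - of_int (i - (P J - P ?K))))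
        - of_int ?b * eta ?K + sigma (Suc ?K) J" for m i
      using value_shifted[of ?K m J i] by simp
    show "\<exists>i::int. - \<bar>\<delta>\<bar> < sgn \<delta> * (of_int (0 + (r (Suc ?K) + q ?K) + t J) * \<theta> - of_int i) \<and>
       sgn \<delta> * (of_int (0 + (r (Suc ?K) + q ?K) + t J) * \<theta> - of_int i) < 0"
    proof -
      let ?m = "0 + (r (Suc ?K) + q ?K)"
      let ?i = "p (Suc ?K) - (?b - 1) * p ?K + (P J - P ?K)"
      have m: "?m + t ?K = q (Suc ?K) - (?b - 1) * q ?K" using rt by (simp add: algebra_simps)
      have "(-1) ^ k * (of_int (?m + t J) * \<theta> - of_int ?i) =
         eta (Suc ?K) + (of_int ?b - 1) * eta ?K - of_int ?b * eta ?K + sigma (Suc ?K) J"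
        unfolding val m using value_last[of ?K ?b] by simp
      then have *: "(-1) ^ k * (of_int (?m + t J) * \<theta> - of_int ?i) = eta (Suc ?K) - eta ?K + sigma (Suc ?K) J"
        by (simp add: algebra_simps)
      have "1 * eta ?K \<le> of_int ?b * eta ?K" using b1 eta_pos[of ?K] by (intro mult_right_mono) auto
      then have "- D < (-1) ^ k * (of_int (?m + t J) * \<theta> - of_int ?i)"
        "(-1) ^ k * (of_int (?m + t J) * \<theta> - of_int ?i) < 0"
        unfolding * D_def using sg eta_pos[of "Suc ?K"] by linarith+
      then show ?thesis unfolding sgn by blast
    qed
    fix m i assume m: "0 < m" "m < 0 + (r (Suc ?K) + q ?K)"
      and h: "- \<bar>\<delta>\<bar> < sgn \<delta> * (of_int (m + t J) * \<theta> - of_int i)"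
       "sgn \<delta> * (of_int (m + t J) * \<theta> - of_int i) < 0"
    define n where "n = m + t ?K"
    \<comment> \<open>A hit at \<open>m\<close> confines \<open>z\<close> to an interval whose
      nonpositive part is ruled out by \<open>no_negative_hit\<close> and whose positive part lies
      below \<open>eta ?K\<close>.\<close>
    define z where "z = (-1) ^ ?K * (of_int n * \<theta> - of_int (i - (P J - P ?K)))"
    have zb: "- of_int ?b * eta ?K + sigma (Suc ?K) J < z" "z < eta (Suc ?K) + sigma (Suc ?K) J"
      using h unfolding sgn val z_def n_def D_def by simp_all
    have n: "1 \<le> n" "n < q (Suc ?K) - (?b - 1) * q ?K"
      using m t_nonneg[of ?K] rt by (simp_all add: n_def algebra_simps)
    have "z > 0" by (rule no_negative_hit[OF n z_def]) (use zb sg in linarith)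
    moreover have "z < eta ?K" using zb sg by linarith
    ultimately have "\<bar>of_int n * \<theta> - of_int (i - (P J - P ?K))\<bar> < eta ?K"
      by (simp add: z_def abs_mult abs_less_iff) (smt (verit) minus_one_power_iff mult_minus_left mult_cancel_right2)
    then have "n = 0" by (rule best_approximation[rotated]) (use n bq in \<open>simp add: algebra_simps\<close>)
    then show False using n by simp
  qed simp
  then show ?thesis by (simp add: Vrt)
qed

text \<open>\<open>V\<close> has one step \<open>q (Suc k)\<close> less than in
  \<open>good_rt_rq\<close>, and the start is \<open>U = r (Suc k)\<close>, so that
  \<open>U + V = r (Suc (Suc k))\<close>.\<close>

lemma good_r_rt:
  assumes c1: "d (Suc (Suc k)) < a (Suc (Suc k))" and c2: "d (Suc (Suc (Suc k))) < a (Suc (Suc (Suc k)))"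
  shows "good (r (Suc (Suc k))) (r (Suc (Suc k)) + t (Suc k))"
proof -
  let ?K = "Suc k"
  let ?b = "d (Suc ?K)"
  define V where "V = (a (Suc ?K) - ?b - 1) * q ?K + q k"
  define \<delta> where "\<delta> = of_int V * \<theta> - of_int ((a (Suc ?K) - ?b - 1) * p ?K + p k)"
  define D where "D = (of_int ?b + 1) * eta ?K + eta (Suc ?K)"
  have b0: "?b \<ge> 0" using d_nonneg by simp
  have Dpos: "D > 0" using b0 eta_pos[of ?K] eta_pos[of "Suc ?K"] by (simp add: D_def add_pos_pos)
  have "\<delta> = (-1) ^ k * (eta k - of_int (a (Suc ?K) - ?b - 1) * eta ?K)"
    by (simp add: \<delta>_def V_def eta_def cf_theta_def algebra_simps minus_one_power_mult_self)
  then have delta: "\<delta> = (-1) ^ k * D" by (simp add: D_def eta_Suc_Suc[of k] algebra_simps)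
  note sgn = sgn_abs_oriented[OF delta Dpos]
  have c0: "a (Suc ?K) - ?b - 1 \<ge> 0" using c1 by simp
  have D1: "D < 1"
  proof -
    have "0 \<le> of_int (a (Suc ?K) - ?b - 1) * eta ?K" using c0 eta_pos[of ?K] by (intro mult_nonneg_nonneg) auto
    then have "D \<le> eta k" by (simp add: D_def eta_Suc_Suc[of k] algebra_simps)
    then show ?thesis using eta_less_1[of k] by simp
  qed
  have rt: "r (Suc ?K) + t ?K = q (Suc ?K) - ?b * q ?K" by (simp add: r_Suc)
  have Vr: "r ?K + V = r (Suc ?K)" using rt r_plus_t[of ?K] by (simp add: V_def q_Suc_Suc algebra_simps)
  have V1: "V \<ge> 1" using c0 q_pos[of k] q_pos[of ?K] unfolding V_def by (smt (verit) mult_nonneg_nonneg)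
  have bq: "0 \<le> ?b * q ?K" using b0 q_pos[of ?K] by simp
  have "good (r ?K + V) (r (Suc ?K) + t ?K)"
  proof (rule good_of_hits[where Jmin = "Suc ?K"])
    show "\<delta> = of_int V * \<theta> - of_int ((a (Suc ?K) - ?b - 1) * p ?K + p k)" by (rule \<delta>_def)
    show "0 < \<bar>\<delta>\<bar>" "\<bar>\<delta>\<bar> < 1" unfolding sgn by fact+
    show "V \<ge> 1" by fact
    show "r ?K \<ge> 0" using r_ge_1[of ?K] by simp
    show "r (Suc ?K) + t ?K \<ge> 1" using r_ge_1[of "Suc ?K"] t_nonneg[of ?K] by simp
    fix J assume J: "J \<ge> Suc ?K"
    note sg = sigma_gt[OF J] sigma_Suc_less_1[OF J c2]
    have val: "(-1) ^ k * (of_int (m + t J) * \<theta> - of_int i) = - ((-1) ^ ?K * (of_int (m + t ?K) * \<theta> - of_int (i - (P J - P ?K))))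
        - of_int ?b * eta ?K + sigma (Suc ?K) J" for m i
      using value_shifted[of ?K m J i] by simp
    show "\<exists>i::int. - \<bar>\<delta>\<bar> < sgn \<delta> * (of_int (r ?K + (r (Suc ?K) + t ?K) + t J) * \<theta> - of_int i) \<and>
       sgn \<delta> * (of_int (r ?K + (r (Suc ?K) + t ?K) + t J) * \<theta> - of_int i) < 0"
    proof -
      let ?m = "r ?K + (r (Suc ?K) + t ?K)"
      let ?i = "p (Suc ?K) - (?b - 1) * p ?K + (P J - P ?K)"
      have m: "?m + t ?K = q (Suc ?K) - (?b - 1) * q ?K" using rt r_plus_t[of ?K] by (simp add: algebra_simps)
      have "(-1) ^ k * (of_int (?m + t J) * \<theta> - of_int ?i) =
         eta (Suc ?K) + (of_int ?b - 1) * eta ?K - of_int ?b * eta ?K + sigma (Suc ?K) J"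
        unfolding val m using value_last[of ?K ?b] by simp
      then have *: "(-1) ^ k * (of_int (?m + t J) * \<theta> - of_int ?i) = eta (Suc ?K) - eta ?K + sigma (Suc ?K) J"
        by (simp add: algebra_simps)
      have "1 * eta ?K \<le> (of_int ?b + 1) * eta ?K" using b0 eta_pos[of ?K] by (intro mult_right_mono) auto
      then have "- D < (-1) ^ k * (of_int (?m + t J) * \<theta> - of_int ?i)"
        "(-1) ^ k * (of_int (?m + t J) * \<theta> - of_int ?i) < 0"
        unfolding * D_def using sg eta_pos[of "Suc ?K"] by linarith+
      then show ?thesis unfolding sgn by blast
    qed
    fix m i assume m: "r ?K < m" "m < r ?K + (r (Suc ?K) + t ?K)"
      and h: "- \<bar>\<delta>\<bar> < sgn \<delta> * (of_int (m + t J) * \<theta> - of_int i)"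
       "sgn \<delta> * (of_int (m + t J) * \<theta> - of_int i) < 0"
    define n where "n = m + t ?K"
    define z where "z = (-1) ^ ?K * (of_int n * \<theta> - of_int (i - (P J - P ?K)))"
    have zb: "- of_int ?b * eta ?K + sigma (Suc ?K) J < z" "z < eta ?K + eta (Suc ?K) + sigma (Suc ?K) J"
      using h unfolding sgn val z_def n_def D_def by (simp_all add: algebra_simps)
    have n: "q ?K < n" "n < q (Suc ?K) - (?b - 1) * q ?K"
      using m rt r_plus_t[of ?K] by (simp_all add: n_def algebra_simps)
    have n1: "1 \<le> n" using n q_pos[of ?K] by simp
    have "z > 0" by (rule no_negative_hit[OF n1 n(2) z_def]) (use zb sg in linarith)
    \<comment> \<open>\<open>n = q ?K\<close> with \<open>z = eta ?K\<close> is a hit at time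
      \<open>r ?K\<close>, excluded by the choice of \<open>U\<close>. Recentring there brings all
      other candidates under \<open>best_approximation\<close>.\<close>
    then have "\<bar>z - eta ?K\<bar> < eta ?K" using zb sg by linarith
    moreover have "z - eta ?K = (-1) ^ ?K * (of_int (n - q ?K) * \<theta> - of_int (i - (P J - P ?K) - p ?K))"
      by (simp add: z_def eta_def cf_theta_def algebra_simps)
    ultimately have "\<bar>of_int (n - q ?K) * \<theta> - of_int (i - (P J - P ?K) - p ?K)\<bar> < eta ?K"
      by (simp only: abs_mult power_abs) simp
    then have "n - q ?K = 0" by (rule best_approximation[rotated]) (use n bq in \<open>simp add: algebra_simps\<close>)
    then show False using n by simp
  qed
  then show ?thesis by (simp add: Vr)
qed

end

section \<open>The chain of approximations\<close>

lemma limsup_along_less_eventually: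
  assumes "limsup_along K f < ereal c"
  shows "\<forall>\<^sub>F k in sequentially. k \<in> K \<longrightarrow> f k < c"
  using Limsup_lessD[OF assms[unfolded limsup_along_def]] by (simp add: eventually_inf_principal)

lemma less_limsup_along_frequently:
  assumes "ereal c < limsup_along K f"
  shows "\<exists>k\<ge>n. k \<in> K \<and> c \<le> f k"
proof (rule ccontr)
  assume "\<not> ?thesis"
  then have "\<forall>\<^sub>F k in sequentially. k \<in> K \<longrightarrow> ereal (f k) \<le> ereal c"
    by (auto simp: eventually_sequentially intro!: exI[of _ n])
  then have "limsup_along K f \<le> ereal c"
    unfolding limsup_along_def by (intro Limsup_bounded) (simp add: eventually_inf_principal)
  then show False using assms by simp
qed

lemma limsup_along_UNIV: "limsup (\<lambda>k. ereal (f k)) = limsup_along UNIV f"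
  by (simp add: limsup_along_def)

context sturmian_number
begin

text \<open>The four kinds of pairs \<open>(e, e')\<close> with \<open>1 + e'/e = \<nu>\<^sub>k(1), \<dots>, \<nu>\<^sub>k(4)\<close>.\<close>

definition link :: "nat \<Rightarrow> int \<Rightarrow> int \<Rightarrow> bool" where
  "link k e e' \<longleftrightarrow>
     (e = r (Suc k) \<and> e' = r (Suc k) + t k \<and> d (Suc k) < a (Suc k) \<and> d (Suc (Suc k)) < a (Suc (Suc k))) \<or>
     (e = r (Suc k) + t k \<and> e' = r (Suc k) + q k \<and> d (Suc (Suc k)) < a (Suc (Suc k))) \<or>
     (e = r (Suc k) + q k \<and> e' = q (Suc k)) \<or>
     (e = q (Suc k) \<and> e' = r (Suc (Suc k)))"

lemma full_digit:
  assumes "d (Suc (Suc k)) = a (Suc (Suc k))"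
  shows "d (Suc k) = 0" "r (Suc (Suc k)) + t (Suc k) = q k" "t (Suc k) = t k"
    "r (Suc k) + t k = q (Suc k)" "d (Suc (Suc k)) \<ge> 1"
proof -
  show d0: "d (Suc k) = 0" using assms by (intro d_rule) auto
  show "r (Suc (Suc k)) + t (Suc k) = q k" using assms by (simp add: r_Suc q_Suc_Suc)
  show "t (Suc k) = t k" "r (Suc k) + t k = q (Suc k)" using d0 by (simp_all add: t_Suc r_Suc)
  show "d (Suc (Suc k)) \<ge> 1" unfolding assms by (rule a_ge_1) simp
qed

lemma r_Suc_Suc:
  "r (Suc (Suc k)) = (a (Suc (Suc k)) - d (Suc (Suc k)) - 1) * q (Suc k) + r (Suc k) + q k"
  using r_Suc[of "Suc k"] r_plus_t[of "Suc k"] by (simp add: q_Suc_Suc algebra_simps)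

lemma r_Suc_Suc_ge:
  assumes "d (Suc (Suc k)) < a (Suc (Suc k))"
  shows "r (Suc (Suc k)) \<ge> r (Suc k) + q k"
proof -
  have "0 \<le> (a (Suc (Suc k)) - d (Suc (Suc k)) - 1) * q (Suc k)"
    using assms q_pos[of "Suc k"] by (intro mult_nonneg_nonneg) auto
  then show ?thesis using r_Suc_Suc[of k] by linarith
qed

text \<open>Forces \<open>e\<close> to infinity along the links, as
  \<open>infinite_approx_set\<close> requires.\<close>

lemma link_ge:
  assumes "link (Suc k) e e'"
  shows "e \<ge> q k"
proof -
  have "r (Suc (Suc k)) + t (Suc k) \<ge> q k"
    using r_Suc_Suc_ge[of k] full_digit(2)[of k] d_le[of "Suc (Suc k)"] r_ge_1[of "Suc k"] t_nonneg[of "Suc k"]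
    by (cases "d (Suc (Suc k)) = a (Suc (Suc k))") auto
  moreover have "d (Suc (Suc k)) < a (Suc (Suc k)) \<Longrightarrow> r (Suc (Suc k)) \<ge> q k"
    using r_Suc_Suc_ge[of k] r_ge_1[of "Suc k"] by simp
  moreover have "q (Suc (Suc k)) \<ge> q k" "q (Suc k) \<ge> q k"
    using q_mono_Suc[of k] q_mono_Suc[of "Suc k"] by auto
  ultimately show ?thesis using assms r_ge_1[of "Suc (Suc k)"] unfolding link_def by auto
qed

text \<open>Substitute for \<open>good_q_r\<close> when its digit condition fails: the full digit
  turns the starting value of \<open>good_rt_rq\<close> at the next index into
  \<open>q (Suc k)\<close>.\<close>

lemma good_of_full_digit:
  assumes "d (Suc (Suc (Suc k))) = a (Suc (Suc (Suc k)))"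
  shows "\<exists>e''. e'' \<ge> r (Suc (Suc k)) \<and> e'' \<ge> q (Suc k) + q (Suc (Suc k)) - t (Suc k) \<and> good (q (Suc k)) e''"
proof -
  note f = full_digit[OF assms]
  have "good (q (Suc k)) (r (Suc (Suc (Suc k))) + q (Suc (Suc k)))"
    using good_rt_rq[OF f(5)] by (simp only: f(2))
  moreover have "r (Suc (Suc (Suc k))) + q (Suc (Suc k)) = q (Suc k) + q (Suc (Suc k)) - t (Suc k)"
    using f by simp
  moreover have "r (Suc (Suc k)) \<le> q (Suc (Suc k)) + q (Suc k) - t (Suc k)"
    using r_le_q[of "Suc (Suc k)"] t_less_q[of "Suc k"] by simp
  ultimately show ?thesis by (metis add.commute order_refl)
qed

text \<open>A pair of a non-valid kind with \<open>e' > e\<close> is dominated by a valid pair with the same \<open>e\<close>,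
  possibly one of a different kind and a larger index.\<close>

lemma link_good:
  assumes "link (Suc k) e e'"
  shows "e' \<le> e \<or> (\<exists>e''. e'' \<ge> e' \<and> good e e'')"
proof -
  let ?K = "Suc k"
  have full: "d (Suc (Suc (Suc ?K))) < a (Suc (Suc (Suc ?K))) \<or> d (Suc (Suc (Suc ?K))) = a (Suc (Suc (Suc ?K)))"
    using d_le[of "Suc (Suc (Suc ?K))"] by auto
  consider "e = r (Suc ?K)" "e' = r (Suc ?K) + t ?K" "d (Suc ?K) < a (Suc ?K)" "d (Suc (Suc ?K)) < a (Suc (Suc ?K))"
    | "e = r (Suc ?K) + t ?K" "e' = r (Suc ?K) + q ?K" "d (Suc (Suc ?K)) < a (Suc (Suc ?K))"
    | "e = r (Suc ?K) + q ?K" "e' = q (Suc ?K)"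
    | "e = q (Suc ?K)" "e' = r (Suc (Suc ?K))"
    using assms unfolding link_def by blast
  then show ?thesis
  proof cases
    case 1
    then show ?thesis using good_r_rt[of k] by blast
  next
    case 2
    show ?thesis
    proof (cases "d (Suc ?K) \<ge> 1")
      case True
      then show ?thesis using 2 good_rt_rq[of k] by blast
    next
      case False
      then have "d (Suc ?K) = 0" using d_nonneg[of "Suc ?K"] by simp
      \<comment> \<open>A zero digit makes \<open>r (Suc ?K) + t ?K = q (Suc ?K)\<close>, so the
        pair shares its \<open>e\<close> with the fourth kind at the same index.\<close>
      then have e: "e = q (Suc ?K)" and t: "t (Suc ?K) = t ?K" using 2 by (simp_all add: r_Suc t_Suc)
      from full show ?thesis
      proof
        assume "d (Suc (Suc (Suc ?K))) < a (Suc (Suc (Suc ?K)))"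
        then have "good (q (Suc ?K)) (r (Suc (Suc ?K)))" by (rule good_q_r)
        moreover have "r (Suc (Suc ?K)) \<ge> e'" using r_Suc_Suc_ge[of ?K] 2 by simp
        ultimately show ?thesis using e by blast
      next
        assume "d (Suc (Suc (Suc ?K))) = a (Suc (Suc (Suc ?K)))"
        then obtain e'' where e'': "e'' \<ge> q (Suc ?K) + q (Suc (Suc ?K)) - t (Suc ?K)" "good (q (Suc ?K)) e''"
          using good_of_full_digit by blast
        have "e'' \<ge> e'" using e'' 2 e t q_Suc_Suc_ge[of ?K] q_pos[of "Suc ?K"] by simp
        then show ?thesis using e e'' by blast
      qed
    qed
  next
    case 3
    consider "d (Suc (Suc ?K)) = a (Suc (Suc ?K))"
      | "d (Suc (Suc ?K)) + 2 \<le> a (Suc (Suc ?K)) \<or>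
         d (Suc (Suc ?K)) + 1 = a (Suc (Suc ?K)) \<and> d (Suc (Suc (Suc ?K))) = a (Suc (Suc (Suc ?K)))"
      | "d (Suc (Suc ?K)) + 1 = a (Suc (Suc ?K))" "d (Suc (Suc (Suc ?K))) < a (Suc (Suc (Suc ?K)))"
      using d_le[of "Suc (Suc ?K)"] full by linarith
    then show ?thesis
    proof cases
      case f: 1
      then show ?thesis using 3 full_digit(4)[OF f] t_less_q[of ?K] by simp
    next
      case 2
      then show ?thesis using good_rq_q[OF 2] 3 by blast
    next
      case c: 3
      \<comment> \<open>Here \<open>r (Suc (Suc ?K)) = r (Suc ?K) + q ?K\<close>, so the first kind
        at the next index starts at the same \<open>e\<close> and reaches beyond
        \<open>q (Suc ?K)\<close>.\<close>
      have "good (r (Suc (Suc ?K))) (r (Suc (Suc ?K)) + t (Suc ?K))"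
        using c by (intro good_r_rt) auto
      moreover have "r (Suc (Suc ?K)) = e" unfolding r_Suc_Suc[of ?K] using c 3 by simp
      moreover have "e + t (Suc ?K) \<ge> e'" using 3 r_plus_t[of "Suc ?K"] q_pos[of ?K] by simp
      ultimately show ?thesis by metis
    qed
  next
    case 4
    from full show ?thesis
    proof
      assume "d (Suc (Suc (Suc ?K))) < a (Suc (Suc (Suc ?K)))"
      then show ?thesis using good_q_r[of "Suc ?K"] 4 by blast
    next
      assume "d (Suc (Suc (Suc ?K))) = a (Suc (Suc (Suc ?K)))"
      then show ?thesis using good_of_full_digit[of ?K] 4 by blast
    qed
  qed
qed

text \<open>With \<open>K = Suc k\<close>, the interval is cut at \<open>r (Suc K)\<close>,
  \<open>r (Suc K) + t K\<close> and \<open>r (Suc K) + q K\<close>. Where the pair of the expected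
  kind is not valid, the piece is empty or a first-kind pair of the next index takes over. If
  \<open>d (Suc (Suc K))\<close> is full, one second-kind pair covers the whole interval.\<close>

lemma good_cover:
  assumes y: "q (Suc k) \<le> y" "y < q (Suc (Suc k))"
  shows "\<exists>j\<ge>k. \<exists>e e'. link j e e' \<and> good e e' \<and> e \<le> y \<and> y < e'"
proof -
  let ?K = "Suc k"
  consider (full) "d (Suc (Suc ?K)) = a (Suc (Suc ?K))"
    | (q) "d (Suc (Suc ?K)) < a (Suc (Suc ?K))" "y < r (Suc ?K)"
    | (r) "d (Suc (Suc ?K)) < a (Suc (Suc ?K))" "r (Suc ?K) \<le> y" "y < r (Suc ?K) + t ?K"
    | (rt) "d (Suc (Suc ?K)) < a (Suc (Suc ?K))" "r (Suc ?K) + t ?K \<le> y" "y < r (Suc ?K) + q ?K"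
    | (rq) "d (Suc (Suc ?K)) < a (Suc (Suc ?K))" "r (Suc ?K) + q ?K \<le> y"
    using d_le[of "Suc (Suc ?K)"] by linarith
  then show ?thesis
  proof cases
    case full
    note f = full_digit[OF full]
    have "d (Suc (Suc (Suc ?K))) < a (Suc (Suc (Suc ?K)))"
      using full_digit(1)[of "Suc ?K"] f(5) d_le[of "Suc (Suc (Suc ?K))"] by force
    then have "link (Suc ?K) (r (Suc (Suc ?K)) + t (Suc ?K)) (r (Suc (Suc ?K)) + q (Suc ?K))"
      unfolding link_def by blast
    moreover have "good (r (Suc (Suc ?K)) + t (Suc ?K)) (r (Suc (Suc ?K)) + q (Suc ?K))"
      using good_rt_rq[of ?K] f(5) by simp
    moreover have "r (Suc (Suc ?K)) + t (Suc ?K) \<le> y" "y < r (Suc (Suc ?K)) + q (Suc ?K)"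
      using y f r_ge_1[of "Suc (Suc ?K)"] by simp_all
    ultimately show ?thesis by (meson Suc_leD le_refl le_Suc_eq)
  next
    case q
    have "link k (q ?K) (r (Suc ?K))" unfolding link_def by blast
    then show ?thesis using good_q_r[of ?K] q y by blast
  next
    case r
    have "d (Suc ?K) < a (Suc ?K)"
    proof (rule ccontr)
      assume "\<not> d (Suc ?K) < a (Suc ?K)"
      then have "d (Suc ?K) = a (Suc ?K)" using d_le[of "Suc ?K"] by simp
      then have "r (Suc ?K) + t ?K = q k" by (rule full_digit(2))
      then show False using r y q_mono_Suc[of k] by simp
    qed
    then have "link ?K (r (Suc ?K)) (r (Suc ?K) + t ?K)" "good (r (Suc ?K)) (r (Suc ?K) + t ?K)"
      using r good_r_rt[of k] unfolding link_def by blast+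
    then show ?thesis using r by (meson le_Suc_eq le_refl)
  next
    case rt
    have "d (Suc ?K) \<ge> 1"
    proof (rule ccontr)
      assume "\<not> d (Suc ?K) \<ge> 1"
      then have "d (Suc ?K) = 0" using d_nonneg[of "Suc ?K"] by simp
      then show False using rt y by (simp add: r_Suc)
    qed
    then have "link ?K (r (Suc ?K) + t ?K) (r (Suc ?K) + q ?K)" "good (r (Suc ?K) + t ?K) (r (Suc ?K) + q ?K)"
      using rt good_rt_rq[of k] unfolding link_def by blast+
    then show ?thesis using rt by (meson le_Suc_eq le_refl)
  next
    case rq
    show ?thesis
    proof (cases "d (Suc (Suc ?K)) + 2 \<le> a (Suc (Suc ?K)) \<or>
         d (Suc (Suc ?K)) + 1 = a (Suc (Suc ?K)) \<and> d (Suc (Suc (Suc ?K))) = a (Suc (Suc (Suc ?K)))")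
      case True
      have "link ?K (r (Suc ?K) + q ?K) (q (Suc ?K))" unfolding link_def by blast
      then show ?thesis using rq y good_rq_q[OF True] by (meson le_Suc_eq le_refl)
    next
      case False
      then have c: "d (Suc (Suc ?K)) + 1 = a (Suc (Suc ?K))" "d (Suc (Suc (Suc ?K))) < a (Suc (Suc (Suc ?K)))"
        using rq d_le[of "Suc (Suc (Suc ?K))"] by linarith+
      have "good (r (Suc (Suc ?K))) (r (Suc (Suc ?K)) + t (Suc ?K))"
        using c by (intro good_r_rt) auto
      moreover have "link (Suc ?K) (r (Suc (Suc ?K))) (r (Suc (Suc ?K)) + t (Suc ?K))"
        using c rq(1) unfolding link_def by blast
      moreover have e: "r (Suc (Suc ?K)) = r (Suc ?K) + q ?K" unfolding r_Suc_Suc[of ?K] using c by simp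
      moreover have "y < r (Suc (Suc ?K)) + t (Suc ?K)"
        unfolding e using y r_plus_t[of "Suc ?K"] q_pos[of ?K] by simp
      ultimately show ?thesis using rq(2) by (metis Suc_leD le_refl le_Suc_eq)
    qed
  qed
qed

text \<open>Supplies exponent at least 2. Full digits are never adjacent, so a valid pair of the
  first or second kind always turns up.\<close>

lemma good_link_ge:
  "\<exists>j\<ge>Suc k. \<exists>e e'. link j e e' \<and> good e e' \<and> e \<le> e'"
proof -
  let ?K = "Suc k"
  consider "d (Suc ?K) < a (Suc ?K)" "d (Suc (Suc ?K)) < a (Suc (Suc ?K))"
    | "d (Suc ?K) = a (Suc ?K)" | "d (Suc (Suc ?K)) = a (Suc (Suc ?K))"
    using d_le[of "Suc ?K"] d_le[of "Suc (Suc ?K)"] by force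
  then show ?thesis
  proof cases
    case 1
    then have "link ?K (r (Suc ?K)) (r (Suc ?K) + t ?K)" "good (r (Suc ?K)) (r (Suc ?K) + t ?K)"
      using good_r_rt[of k] unfolding link_def by blast+
    moreover have "r (Suc ?K) \<le> r (Suc ?K) + t ?K" using t_nonneg by simp
    ultimately show ?thesis by blast
  next
    case 2
    note f = full_digit[OF 2]
    have "d (Suc (Suc ?K)) < a (Suc (Suc ?K))"
      using full_digit(1)[of ?K] f(5) d_le[of "Suc (Suc ?K)"] by force
    then have "link ?K (r (Suc ?K) + t ?K) (r (Suc ?K) + q ?K)" "good (r (Suc ?K) + t ?K) (r (Suc ?K) + q ?K)"
      using good_rt_rq[of k] f(5) unfolding link_def by blast+
    moreover have "r (Suc ?K) + t ?K \<le> r (Suc ?K) + q ?K" using t_less_q[of ?K] by simp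
    ultimately show ?thesis by blast
  next
    case 3
    note f = full_digit[OF 3]
    have "d (Suc (Suc (Suc ?K))) < a (Suc (Suc (Suc ?K)))"
      using full_digit(1)[of "Suc ?K"] f(5) d_le[of "Suc (Suc (Suc ?K))"] by force
    then have "link (Suc ?K) (r (Suc (Suc ?K)) + t (Suc ?K)) (r (Suc (Suc ?K)) + q (Suc ?K))"
      "good (r (Suc (Suc ?K)) + t (Suc ?K)) (r (Suc (Suc ?K)) + q (Suc ?K))"
      using good_rt_rq[of ?K] f(5) unfolding link_def by blast+
    moreover have "r (Suc (Suc ?K)) + t (Suc ?K) \<le> r (Suc (Suc ?K)) + q (Suc ?K)" using t_less_q[of "Suc ?K"] by simp
    ultimately show ?thesis by (meson le_Suc_eq le_refl)
  qed
qed

section \<open>The exponent as a limit superior over the links\<close>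

definition nu_max :: ereal where
  "nu_max = Max {nu1 \<theta> d, nu2 \<theta> d, nu3 \<theta> d, nu4 \<theta> d}"

lemma nu_seq_eq:
  "nu1_seq \<theta> d k = 1 + of_int (r (Suc k) + t k) / of_int (r (Suc k))"
  "nu2_seq \<theta> d k = 1 + of_int (r (Suc k) + q k) / of_int (r (Suc k) + t k)"
  "nu3_seq \<theta> d k = 1 + of_int (q (Suc k)) / of_int (r (Suc k) + q k)"
  "nu4_seq \<theta> d k = 1 + of_int (r (Suc (Suc k))) / of_int (q (Suc k))"
proof -
  have "real_of_int (r (Suc k)) > 0" "real_of_int (r (Suc k) + t k) > 0"
    using r_ge_1[of "Suc k"] t_nonneg[of k] by simp_all
  moreover have "real_of_int (q k) = of_int (r k) + of_int (t k)" using r_plus_t[of k] by (metis of_int_add)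
  ultimately show "nu1_seq \<theta> d k = 1 + of_int (r (Suc k) + t k) / of_int (r (Suc k))"
    "nu2_seq \<theta> d k = 1 + of_int (r (Suc k) + q k) / of_int (r (Suc k) + t k)"
    by (simp_all add: nu1_seq_def nu2_seq_def field_simps)
qed (simp_all add: nu3_seq_def nu4_seq_def)

lemma link_less:
  assumes "nu_max < ereal c"
  shows "\<exists>k0. \<forall>k\<ge>k0. \<forall>e e'. link k e e' \<longrightarrow> of_int e + of_int e' \<le> c * of_int e"
proof -
  have "nu1 \<theta> d < ereal c" "nu2 \<theta> d < ereal c" "nu3 \<theta> d < ereal c" "nu4 \<theta> d < ereal c"
    using assms by (auto simp: nu_max_def)
  note * = this[unfolded nu1_def nu2_def nu3_def nu4_def limsup_along_UNIV, THEN limsup_along_less_eventually]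
  have "\<forall>\<^sub>F k in sequentially. \<forall>e e'. link k e e' \<longrightarrow> of_int e + of_int e' \<le> c * of_int e"
    using *
  proof eventually_elim
    case (elim k)
    show ?case
    proof (intro allI impI)
      fix e e' assume l: "link k e e'"
      have e: "e \<ge> 1" using l r_ge_1[of "Suc k"] t_nonneg[of k] q_pos[of k] q_pos[of "Suc k"]
        unfolding link_def by auto
      have "1 + of_int e' / real_of_int e < c"
        using l elim unfolding link_def nu_seq_eq by (auto simp: add.commute[of _ 2])
      then show "of_int e + of_int e' \<le> c * of_int e" using e by (simp add: field_simps)
    qed
  qed
  then show ?thesis by (simp add: eventually_sequentially)
qed

lemma link_greater:
  assumes "ereal c < nu_max"
  shows "\<exists>k\<ge>n. \<exists>e e'. link k e e' \<and> c * of_int e \<le> of_int e + of_int e'"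
proof -
  have pos: "real_of_int (r (Suc k)) > 0" "real_of_int (r (Suc k) + t k) > 0" "real_of_int (r (Suc k) + q k) > 0"
    "real_of_int (q (Suc k)) > 0" for k
    using r_ge_1[of "Suc k"] t_nonneg[of k] q_pos[of k] q_pos[of "Suc k"] by simp_all
  have mul: "c * of_int e \<le> of_int e + of_int e'" if "c \<le> 1 + of_int e' / of_int e" "real_of_int e > 0" for e e'
    using that by (simp add: field_simps)
  have "ereal c < nu1 \<theta> d \<or> ereal c < nu2 \<theta> d \<or> ereal c < nu3 \<theta> d \<or> ereal c < nu4 \<theta> d"
    using assms by (simp add: nu_max_def less_max_iff_disj)
  then show ?thesis
  proof (elim disjE)
    assume "ereal c < nu1 \<theta> d"
    from less_limsup_along_frequently[OF this[unfolded nu1_def], of n] obtain k where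
      k: "k \<ge> n" "d (Suc k) < a (Suc k)" "d (Suc (Suc k)) < a (Suc (Suc k))" "c \<le> nu1_seq \<theta> d k" by auto
    have "link k (r (Suc k)) (r (Suc k) + t k)" using k unfolding link_def by blast
    then show ?thesis using k mul pos unfolding nu_seq_eq by blast
  next
    assume "ereal c < nu2 \<theta> d"
    from less_limsup_along_frequently[OF this[unfolded nu2_def], of n] obtain k where
      k: "k \<ge> n" "d (Suc (Suc k)) < a (Suc (Suc k))" "c \<le> nu2_seq \<theta> d k" by auto
    have "link k (r (Suc k) + t k) (r (Suc k) + q k)" using k unfolding link_def by blast
    then show ?thesis using k mul pos unfolding nu_seq_eq by blast
  next
    assume "ereal c < nu3 \<theta> d"
    from less_limsup_along_frequently[OF this[unfolded nu3_def limsup_along_UNIV], of n] obtain k where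
      k: "k \<ge> n" "c \<le> nu3_seq \<theta> d k" by auto
    have "link k (r (Suc k) + q k) (q (Suc k))" using k unfolding link_def by blast
    then show ?thesis using k mul pos unfolding nu_seq_eq by blast
  next
    assume "ereal c < nu4 \<theta> d"
    from less_limsup_along_frequently[OF this[unfolded nu4_def limsup_along_UNIV], of n] obtain k where
      k: "k \<ge> n" "c \<le> nu4_seq \<theta> d k" by auto
    have "link k (q (Suc k)) (r (Suc (Suc k)))" using k unfolding link_def by blast
    then show ?thesis using k mul pos unfolding nu_seq_eq by blast
  qed
qed

lemma two_le_nu_max: "2 \<le> nu_max"
proof (rule ccontr)
  assume "\<not> 2 \<le> nu_max"
  then obtain c where c: "nu_max < ereal c" "ereal c < ereal 2"
    using ereal_dense2[of nu_max "ereal 2"] by (auto simp: not_le)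
  obtain k0 where k0: "\<forall>k\<ge>k0. \<forall>e e'. link k e e' \<longrightarrow> of_int e + of_int e' \<le> c * of_int e"
    using link_less[OF c(1)] by blast
  obtain j e e' where j: "j \<ge> Suc k0" "link j e e'" "e \<le> e'" using good_link_ge[of k0] by blast
  obtain j' where j': "j = Suc j'" using j(1) by (cases j) auto
  have "e \<ge> 1" using link_ge[of j' e e'] j(2) j' q_pos[of j'] by simp
  then have "c * of_int e < 2 * of_int e" using c(2) by simp
  moreover have "real_of_int e \<le> of_int e'" using j(3) by simp
  moreover have "of_int e + of_int e' \<le> c * of_int e" using k0 j(1,2) Suc_leD by blast
  ultimately show False by linarith
qed

lemma nu_max_le: "infinite (approx_set \<xi> \<mu>) \<Longrightarrow> ereal \<mu> \<le> nu_max"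
proof (rule ccontr)
  assume inf: "infinite (approx_set \<xi> \<mu>)" and "\<not> ereal \<mu> \<le> nu_max"
  then obtain c where c: "nu_max < ereal c" "ereal c < ereal \<mu>"
    using ereal_dense2[of nu_max "ereal \<mu>"] by (auto simp: not_le)
  have "ereal 2 < ereal c" using order_le_less_trans[OF two_le_nu_max c(1)] by simp
  then have c2: "2 \<le> c" by simp
  obtain k0 where k0: "\<forall>k\<ge>k0. \<forall>e e'. link k e e' \<longrightarrow> of_int e + of_int e' \<le> c * of_int e"
    using link_less[OF c(1)] by blast
  have "finite (approx_set \<xi> \<mu>)"
  proof (rule finite_approx_set[where B = "of_int b" and \<nu> = c and ymin = "nat (q (Suc k0))"])
    show "2 \<le> real_of_int b" using b by simp
    show "2 \<le> c" by fact
    show "c < \<mu>" using c by simp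
    fix y :: nat assume y: "y \<ge> nat (q (Suc k0))"
    \<comment> \<open>Minimality places \<open>y\<close> between two consecutive denominators, where
      \<open>good_cover\<close> applies.\<close>
    define k where "k = (LEAST k. int y < q k)"
    have ex: "int y < q (Suc y)" using q_ge_index[of "Suc y"] by simp
    have yk: "int y < q k" unfolding k_def using ex by (rule LeastI)
    have mono: "q i \<le> q j" if "i \<le> j" for i j using that q_mono_Suc by (rule lift_Suc_mono_le[rotated])
    have "\<not> k \<le> Suc k0" using y yk mono[of k "Suc k0"] by linarith
    then obtain j where j: "k = Suc (Suc j)" "j \<ge> k0" by (metis Suc_le_D Suc_le_mono not_less_eq_eq)
    have "\<not> int y < q (Suc j)" using not_less_Least[of "Suc j" "\<lambda>k. int y < q k"] j unfolding k_def by simp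
    then obtain i e e' where i: "i \<ge> j" "link i e e'" "good e e'" "e \<le> int y" "int y < e'"
      using good_cover[of j "int y"] yk j by (auto simp: not_less)
    have "of_int e + of_int e' \<le> c * of_int e" using k0 i(1,2) j(2) order_trans by blast
    moreover have "real_of_int e \<le> real y" "real y < real_of_int e'" using i by linarith+
    ultimately show "\<exists>e e'. good_approx (of_int b) \<xi> e e' \<and> e \<le> real y \<and> real y < e' \<and> e + e' \<le> c * e"
      using i by blast
  qed
  then show False using inf by simp
qed

text \<open>Up to exponent 2 the pairs of \<open>good_link_ge\<close> suffice. Beyond 2 a link with
  ratio \<open>c'\<close> has \<open>e' > e\<close>, so \<open>link_good\<close> yields a valid pair
  with the same \<open>e\<close>. The maxima keep the exponents nonnegative.\<close>

lemma infinite_approx_set_less_nu_max: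
  assumes "ereal c' < nu_max" "c < c'"
  shows "infinite (approx_set \<xi> (max c 0))"
proof (rule infinite_approx_set[where B = "of_int b" and c' = "max c' 1"])
  show "2 \<le> real_of_int b" using b by simp
  show "max c 0 < max c' 1" using assms by auto
  fix K :: real
  define n where "n = nat \<lceil>K\<rceil>"
  have K: "K \<le> real n" unfolding n_def by linarith
  have eK: "K \<le> of_int e" "e \<ge> 1" if l: "link j e e'" and j: "j \<ge> Suc n" for j e e'
  proof -
    obtain i where i: "j = Suc i" "i \<ge> n" using j by (cases j) auto
    have "e \<ge> q i" using link_ge l i by blast
    then show "K \<le> of_int e" "e \<ge> 1" using K i q_ge_index[of i] q_pos[of i] by linarith+
  qed
  show "\<exists>e e'. e \<ge> K \<and> good_approx (of_int b) \<xi> e e' \<and> max c' 1 * e \<le> e + e'"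
  proof (cases "c' \<le> 2")
    case True
    obtain j e e' where j: "j \<ge> Suc n" "link j e e'" "good e e'" "e \<le> e'" using good_link_ge[of n] by blast
    have "max c' 1 * of_int e \<le> 2 * of_int e" using True eK(2)[OF j(2,1)] by (intro mult_right_mono) auto
    then have "max c' 1 * of_int e \<le> of_int e + real_of_int e'" using j(4) by linarith
    then show ?thesis using j eK by blast
  next
    case False
    obtain j e e' where j: "j \<ge> Suc n" "link j e e'" "c' * of_int e \<le> of_int e + of_int e'"
      using link_greater[OF assms(1), of "Suc n"] by blast
    have e: "K \<le> of_int e" "e \<ge> 1" using eK j by blast+
    have "2 * of_int e < c' * of_int e" using False e by (intro mult_strict_right_mono) auto
    then have "\<not> e' \<le> e" using j(3) by linarith
    then obtain e'' where "e'' \<ge> e'" "good e e''"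
      using link_good[of "j - 1" e e'] j(1,2) by (cases j) auto
    moreover have "max c' 1 = c'" using False by simp
    ultimately show ?thesis using e j(3) by (intro exI[of _ "of_int e"] exI[of _ "of_int e''"]) simp
  qed
qed simp

theorem irrationality_exponent_eq: "irrationality_exponent \<xi> = nu_max"
proof -
  define A where "A = {ereal \<mu> |\<mu>. infinite (approx_set \<xi> \<mu>)}"
  have "irrationality_exponent \<xi> = Sup A"
    unfolding irrationality_exponent_def A_def approx_set_def by simp
  also have "Sup A = nu_max"
  proof (rule antisym)
    show "Sup A \<le> nu_max" by (rule Sup_least) (auto simp: A_def nu_max_le)
    show "nu_max \<le> Sup A"
    proof (rule dense_le)
      fix x assume "x < nu_max"
      then obtain c' where c': "x < ereal c'" "ereal c' < nu_max" using ereal_dense2 by blast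
      then obtain c where c: "x < ereal c" "ereal c < ereal c'" using ereal_dense2 by blast
      have "ereal (max c 0) \<in> A" unfolding A_def using infinite_approx_set_less_nu_max[OF c'(2)] c
        by (simp del: ereal_max)
      then have "ereal (max c 0) \<le> Sup A" by (rule Sup_upper)
      moreover have "x \<le> ereal (max c 0)" using c(1) by (meson ereal_less_eq(3) less_imp_le max.cobounded1 order_trans)
      ultimately show "x \<le> Sup A" by (rule order_trans[rotated])
    qed
  qed
  finally show ?thesis .
qed

end

section \<open>The digit sequences attached to an intercept\<close>

lemma summable_linear_over_power:
  fixes Y :: "nat \<Rightarrow> int" and b :: int and c :: real
  assumes b: "b \<ge> 2" and Y: "\<And>n. \<bar>of_int (Y (Suc n))\<bar> \<le> real n + c"
  shows "summable (\<lambda>n. of_int (Y (Suc n)) / real_of_int b ^ Suc n)"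
proof (rule summable_comparison_test')
  show "summable (\<lambda>n. (2 + c) * (3 / 4 :: real) ^ n)" by (intro summable_mult summable_geometric) simp
  fix n :: nat
  have c: "c \<ge> 0" using Y[of 0] by simp
  \<comment> \<open>Linear growth is traded for \<open>(3 / 2) ^ n\<close>; against
    \<open>b ^ n \<ge> 2 ^ n\<close> this leaves the ratio 3/4.\<close>
  have "1 + real n * (1 / 2) \<le> (1 + 1 / 2) ^ n" by (rule Bernoulli_inequality) simp
  then have n: "real n \<le> 2 * (3 / 2) ^ n" by simp
  have "(1 :: real) \<le> (3 / 2) ^ n" by (rule one_le_power) simp
  then have "c * 1 \<le> c * (3 / 2) ^ n" using c by (intro mult_left_mono)
  then have Yn: "\<bar>of_int (Y (Suc n))\<bar> \<le> (2 + c) * (3 / 2) ^ n" using Y[of n] n by (simp add: algebra_simps)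
  have "(2 :: real) ^ n \<le> of_int b ^ n" using b by (intro power_mono) auto
  also have "\<dots> \<le> of_int b ^ Suc n" using b by simp
  finally have "\<bar>of_int (Y (Suc n))\<bar> / real_of_int b ^ Suc n \<le> (2 + c) * (3 / 2) ^ n / 2 ^ n"
    using Yn by (intro frac_le) auto
  also have "\<dots> = (2 + c) * (3 / 4) ^ n" by (simp add: power_divide flip: power_mult_distrib)
  finally show "norm (of_int (Y (Suc n)) / real_of_int b ^ Suc n) \<le> (2 + c) * (3 / 4) ^ n"
    using b by (simp add: abs_mult power_abs)
qed

lemma floor_eventually_eq_right:
  fixes f :: "nat \<Rightarrow> real"
  assumes "f \<longlonglongrightarrow> x" "x \<notin> \<int> \<or> (\<forall>\<^sub>F n in sequentially. x \<le> f n)"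
  shows "\<forall>\<^sub>F n in sequentially. \<lfloor>f n\<rfloor> = \<lfloor>x\<rfloor>"
proof -
  have "\<forall>\<^sub>F n in sequentially. of_int \<lfloor>x\<rfloor> \<le> f n"
    using assms(2)
  proof
    assume "x \<notin> \<int>"
    then have "of_int \<lfloor>x\<rfloor> < x" by (metis Ints_of_int of_int_floor_le order_less_le)
    then have "\<forall>\<^sub>F n in sequentially. of_int \<lfloor>x\<rfloor> < f n" by (rule order_tendstoD[OF assms(1)])
    then show ?thesis by eventually_elim simp
  next
    assume "\<forall>\<^sub>F n in sequentially. x \<le> f n"
    then show ?thesis by eventually_elim linarith
  qed
  moreover have "\<forall>\<^sub>F n in sequentially. f n < of_int \<lfloor>x\<rfloor> + 1"
    by (rule order_tendstoD[OF assms(1)]) linarith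
  ultimately show ?thesis by eventually_elim linarith
qed

text \<open>At an integer \<open>x\<close> the floor jumps, and approach from below yields its left
  limit \<open>\<lceil>x\<rceil> - 1\<close>.\<close>

lemma floor_eventually_eq_left:
  fixes f :: "nat \<Rightarrow> real"
  assumes "f \<longlonglongrightarrow> x" "x \<notin> \<int> \<or> (\<forall>\<^sub>F n in sequentially. f n < x)"
  shows "\<forall>\<^sub>F n in sequentially. \<lfloor>f n\<rfloor> = \<lceil>x\<rceil> - 1"
proof -
  have "\<forall>\<^sub>F n in sequentially. f n < of_int \<lceil>x\<rceil>"
    using assms(2)
  proof
    assume "x \<notin> \<int>"
    then have "x < of_int \<lceil>x\<rceil>" by (metis Ints_of_int le_of_int_ceiling order_less_le)
    then show ?thesis by (rule order_tendstoD[OF assms(1)])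
  next
    assume "\<forall>\<^sub>F n in sequentially. f n < x"
    then show ?thesis by eventually_elim linarith
  qed
  moreover have "\<forall>\<^sub>F n in sequentially. of_int \<lceil>x\<rceil> - 1 < f n"
    by (rule order_tendstoD[OF assms(1)]) linarith
  ultimately show ?thesis by eventually_elim linarith
qed

section \<open>From digit sums to the floor and ceiling series\<close>

context ostrowski_digits
begin

text \<open>\<open>Y\<close> stays near a line of slope \<open>\<theta>\<close>, which gives
  summability; \<open>t J * \<theta>\<close> and \<open>S J\<close> differ by the integer
  \<open>P J\<close>, which gives \<open>Y_eventually\<close>.\<close>

lemma xi_exponent:
  fixes b :: int and L \<xi> :: real and Y :: "nat \<Rightarrow> int"
  assumes b: "b \<ge> 2"
    and xi: "\<xi> = (of_int b - 1) * (\<Sum>n. of_int (Y (Suc (Suc n)) - Y (Suc n)) / of_int b ^ Suc n)"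
    and Y: "\<And>m. \<bar>of_int (Y m) - (real m * \<theta> + L)\<bar> \<le> 1"
    and ev: "\<And>m. m \<ge> 1 \<Longrightarrow> \<forall>\<^sub>F J in sequentially. \<lfloor>real m * \<theta> + S J\<rfloor> = Y m"
  shows "irrationality_exponent \<xi> = Max {nu1 \<theta> d, nu2 \<theta> d, nu3 \<theta> d, nu4 \<theta> d}"
proof -
  have "sturmian_number \<theta> d b \<xi> Y"
  proof (unfold_locales)
    show "b \<ge> 2" by fact
    show "\<xi> = (of_int b - 1) * (\<Sum>n. of_int (Y (Suc (Suc n)) - Y (Suc n)) / of_int b ^ Suc n)" by fact
    show "summable (\<lambda>n. of_int (Y (Suc n)) / real_of_int b ^ Suc n)"
    proof (rule summable_linear_over_power[OF b, where c = "2 + \<bar>L\<bar>"])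
      fix n
      have "real (Suc n) * \<theta> \<le> real (Suc n) * 1" using theta by (intro mult_left_mono) auto
      then have "real (Suc n) * \<theta> \<le> real n + 1" by (simp only: of_nat_Suc mult_1_right add.commute)
      moreover have "0 \<le> real (Suc n) * \<theta>" using theta by (intro mult_nonneg_nonneg) auto
      ultimately show "\<bar>of_int (Y (Suc n))\<bar> \<le> real n + (2 + \<bar>L\<bar>)" using Y[of "Suc n"] by linarith
    qed
    fix m :: nat assume "m \<ge> 1"
    from ev[OF this] obtain J0 where J0: "\<forall>J\<ge>J0. \<lfloor>real m * \<theta> + S J\<rfloor> = Y m"
      by (auto simp: eventually_sequentially)
    have "\<lfloor>(real m + of_int (t J)) * \<theta>\<rfloor> - P J = \<lfloor>real m * \<theta> + S J\<rfloor>" for J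
    proof -
      have "(real m + of_int (t J)) * \<theta> = real m * \<theta> + S J + of_int (P J)"
        by (simp add: S_eq algebra_simps)
      then show ?thesis by simp
    qed
    then show "\<exists>J0. \<forall>J\<ge>J0. Y m = \<lfloor>(real m + of_int (t J)) * \<theta>\<rfloor> - (\<Sum>j<J. d (Suc j) * p j)"
      using J0 unfolding P_def by metis
  qed
  then interpret sturmian_number \<theta> d b \<xi> Y .
  show ?thesis using irrationality_exponent_eq unfolding nu_max_def .
qed

text \<open>The term \<open>- \<theta>\<close> in \<open>L\<close> shifts the index so that
  \<open>m = 1\<close> corresponds to the intercept \<open>\<rho>\<close>; the integer
  \<open>C\<close> cancels in differences of \<open>Y\<close>.\<close>

lemma xi_lower_exponent:
  fixes b C :: int and \<rho> L :: real
  assumes b: "b \<ge> 2" and L: "L = \<rho> - \<theta> + of_int C" and lim: "S \<longlonglongrightarrow> L"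
    and side: "\<And>m. m \<ge> 1 \<Longrightarrow> real m * \<theta> + L \<notin> \<int> \<or> (\<forall>\<^sub>F J in sequentially. L \<le> S J)"
  shows "irrationality_exponent (xi_lower b \<theta> \<rho>) = Max {nu1 \<theta> d, nu2 \<theta> d, nu3 \<theta> d, nu4 \<theta> d}"
proof (rule xi_exponent[OF b, where L = L and Y = "\<lambda>m. \<lfloor>real m * \<theta> + L\<rfloor>"])
  have Y: "\<lfloor>real m * \<theta> + L\<rfloor> = \<lfloor>(real m - 1) * \<theta> + \<rho>\<rfloor> + C" for m
  proof -
    have "real m * \<theta> + L = (real m - 1) * \<theta> + \<rho> + of_int C" by (simp add: L algebra_simps)
    then show ?thesis by simp
  qed
  have "sturm_lower \<theta> \<rho> (Suc n) = \<lfloor>real (Suc (Suc n)) * \<theta> + L\<rfloor> - \<lfloor>real (Suc n) * \<theta> + L\<rfloor>" for n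
    unfolding sturm_lower_def Y by simp
  then show "xi_lower b \<theta> \<rho> = (of_int b - 1) *
     (\<Sum>n. of_int (\<lfloor>real (Suc (Suc n)) * \<theta> + L\<rfloor> - \<lfloor>real (Suc n) * \<theta> + L\<rfloor>) / of_int b ^ Suc n)"
    unfolding xi_lower_def by (simp only:)
  show "\<bar>of_int \<lfloor>real m * \<theta> + L\<rfloor> - (real m * \<theta> + L)\<bar> \<le> 1" for m by linarith
  fix m :: nat assume "m \<ge> 1"
  show "\<forall>\<^sub>F J in sequentially. \<lfloor>real m * \<theta> + S J\<rfloor> = \<lfloor>real m * \<theta> + L\<rfloor>"
    using side[OF \<open>m \<ge> 1\<close>] by (intro floor_eventually_eq_right tendsto_add lim tendsto_const) simp
qed

text \<open>\<open>Y\<close> is the left limit of the floor, matching partial sums that approach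
  from below; the constant 1 cancels in differences.\<close>

lemma xi_upper_exponent:
  fixes b C :: int and \<rho> L :: real
  assumes b: "b \<ge> 2" and L: "L = \<rho> - \<theta> + of_int C" and lim: "S \<longlonglongrightarrow> L"
    and side: "\<And>m. m \<ge> 1 \<Longrightarrow> real m * \<theta> + L \<notin> \<int> \<or> (\<forall>\<^sub>F J in sequentially. S J < L)"
  shows "irrationality_exponent (xi_upper b \<theta> \<rho>) = Max {nu1 \<theta> d, nu2 \<theta> d, nu3 \<theta> d, nu4 \<theta> d}"
proof (rule xi_exponent[OF b, where L = L and Y = "\<lambda>m. \<lceil>real m * \<theta> + L\<rceil> - 1"])
  have Y: "\<lceil>real m * \<theta> + L\<rceil> = \<lceil>(real m - 1) * \<theta> + \<rho>\<rceil> + C" for m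
  proof -
    have "real m * \<theta> + L = (real m - 1) * \<theta> + \<rho> + of_int C" by (simp add: L algebra_simps)
    then show ?thesis by simp
  qed
  have "sturm_upper \<theta> \<rho> (Suc n) = (\<lceil>real (Suc (Suc n)) * \<theta> + L\<rceil> - 1) - (\<lceil>real (Suc n) * \<theta> + L\<rceil> - 1)" for n
    unfolding sturm_upper_def Y by simp
  then show "xi_upper b \<theta> \<rho> = (of_int b - 1) *
     (\<Sum>n. of_int ((\<lceil>real (Suc (Suc n)) * \<theta> + L\<rceil> - 1) - (\<lceil>real (Suc n) * \<theta> + L\<rceil> - 1)) / of_int b ^ Suc n)"
    unfolding xi_upper_def by (simp only:)
  show "\<bar>of_int (\<lceil>real m * \<theta> + L\<rceil> - 1) - (real m * \<theta> + L)\<bar> \<le> 1" for m by linarith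
  fix m :: nat assume "m \<ge> 1"
  show "\<forall>\<^sub>F J in sequentially. \<lfloor>real m * \<theta> + S J\<rfloor> = \<lceil>real m * \<theta> + L\<rceil> - 1"
    using side[OF \<open>m \<ge> 1\<close>] by (intro floor_eventually_eq_left tendsto_add lim tendsto_const) simp
qed

text \<open>The digits of intercepts in \<open>\<int>\<^sub>\<le>\<^sub>0\<theta> + \<int>\<close> end in \<open>0, a, 0, a, \<dots>\<close>; telescoping gives the deviation of
  the partial sums exactly, and its sign decides between the floor and the ceiling version.\<close>

lemma alternating_tail:
  assumes S0: "S K = L + cf_theta \<theta> K"
    and tail: "\<And>i. d (K + 2 * i + 1) = 0" "\<And>i. d (K + 2 * i + 2) = a (K + 2 * i + 2)"
  shows "S \<longlonglongrightarrow> L" "even K \<Longrightarrow> \<forall>\<^sub>F J in sequentially. L \<le> S J" "odd K \<Longrightarrow> \<forall>\<^sub>F J in sequentially. S J < L"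
proof -
  have even: "S (K + 2 * i) = L + cf_theta \<theta> (K + 2 * i)" for i
  proof (induction i)
    case (Suc i)
    have "S (K + 2 * Suc i) = S (K + 2 * i) + of_int (a (K + 2 * i + 2)) * cf_theta \<theta> (K + 2 * i + 1)"
      using tail[of i] by (simp add: S_Suc)
    then show ?case using Suc cf_theta_Suc_Suc[of "K + 2 * i"] by simp
  qed (use S0 in simp)
  have odd: "S (K + 2 * i + 1) = L + cf_theta \<theta> (K + 2 * i)" for i
    using even[of i] tail(1)[of i] by (simp add: S_Suc)
  \<comment> \<open>The deviation is always some \<open>cf_theta \<theta> j\<close> with
    \<open>j\<close> of the parity of \<open>K\<close>, which fixes its sign, and \<open>j\<close>
    at least \<open>J - 1\<close>, which makes it small.\<close>
  have S: "\<exists>j. J \<le> Suc j \<and> even (j + K) \<and> S J = L + cf_theta \<theta> j" if "J \<ge> K" for J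
  proof (cases "even (J - K)")
    case True
    then obtain i where "J - K = 2 * i" by (rule evenE)
    then have "J = K + 2 * i" using that by simp
    then show ?thesis using even[of i] by (intro exI[of _ J]) auto
  next
    case False
    then obtain i where "J - K = 2 * i + 1" by (rule oddE)
    then have "J = K + 2 * i + 1" using that by simp
    then show ?thesis using odd[of i] by (intro exI[of _ "K + 2 * i"]) auto
  qed
  have bound: "norm (S J - L) \<le> norm (1 / real J) * 1" if "J \<ge> K" "J \<ge> 1" for J
  proof -
    obtain j where j: "J \<le> Suc j" "S J = L + cf_theta \<theta> j" using S \<open>J \<ge> K\<close> by blast
    have "norm (S J - L) = eta j" using j eta_pos[of j] by (simp add: cf_theta_eta abs_mult)
    also have "\<dots> \<le> 1 / real (Suc j)" by (rule eta_le_inverse)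
    also have "\<dots> \<le> 1 / real J" using j \<open>J \<ge> 1\<close> by (intro divide_left_mono) auto
    finally show ?thesis by simp
  qed
  have "(\<lambda>J. S J - L) \<longlonglongrightarrow> 0"
  proof (rule tendsto_0_le[where K = 1])
    show "(\<lambda>J. 1 / real J) \<longlonglongrightarrow> 0" by (rule lim_1_over_n)
    show "\<forall>\<^sub>F J in sequentially. norm (S J - L) \<le> norm (1 / real J) * 1"
      by (rule eventually_mono[OF eventually_ge_at_top[of "max K 1"] bound]) auto
  qed
  then show "S \<longlonglongrightarrow> L" by (rule LIM_zero_cancel)
  show "\<forall>\<^sub>F J in sequentially. L \<le> S J" if "even K"
  proof -
    have *: "L \<le> S J" if "J \<ge> K" for J
      using S[OF that] \<open>even K\<close> by (auto simp: cf_theta_eta less_imp_le[OF eta_pos])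
    show ?thesis by (rule eventually_mono[OF eventually_ge_at_top[of K] *])
  qed
  show "\<forall>\<^sub>F J in sequentially. S J < L" if "odd K"
  proof -
    have *: "S J < L" if "J \<ge> K" for J
      using S[OF that] \<open>odd K\<close> by (auto simp: cf_theta_eta eta_pos)
    show ?thesis by (rule eventually_mono[OF eventually_ge_at_top[of K] *])
  qed
qed

end

lemma nat_above_cases:
  fixes k l :: nat
  assumes "k > l + 1"
  obtains j where "j \<ge> 1" "k = l + 2 * j" | j where "j \<ge> 1" "k = l + 2 * j + 1"
proof (cases "even (k - l)")
  case True
  then obtain j where "k - l = 2 * j" by (rule evenE)
  then show ?thesis using assms that(1)[of j] by simp
next
  case False
  then obtain j where "k - l = 2 * j + 1" by (rule oddE)
  then show ?thesis using assms that(2)[of j] by simp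
qed

section \<open>The digit sequences \<open>\<beta>\<close> and \<open>\<beta>'\<close>\<close>

context irrational_cf
begin

text \<open>For \<open>m = 1\<close> the digit \<open>a 1 - 1\<close> expands
  \<open>q 1 - 1\<close>, so this case has the shape of the other one with
  \<open>l = 0\<close>.\<close>

lemma neg_digits_beta_prefix_tail:
  assumes nd: "neg_digits \<theta> m l \<beta> \<beta>'"
  shows "ostrowski_int \<theta> (l + 1) (q (l + 1) - m) \<beta>"
    "j \<ge> 1 \<Longrightarrow> \<beta> (l + 2 * j) = 0" "j \<ge> 1 \<Longrightarrow> \<beta> (l + 2 * j + 1) = a (l + 2 * j + 1)"
proof -
  have "ostrowski_int \<theta> (l + 1) (q (l + 1) - m) \<beta> \<and>
    (\<forall>j\<ge>1. \<beta> (l + 2 * j) = 0 \<and> \<beta> (l + 2 * j + 1) = a (l + 2 * j + 1))"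
    using nd unfolding neg_digits_def
  proof (elim disjE conjE)
    assume m: "m = 1" "l = 0" and b1: "\<beta> 1 = a 1 - 1"
      and bt: "\<forall>j\<ge>1. \<beta> (2 * j) = 0 \<and> \<beta> (2 * j + 1) = a (2 * j + 1)"
    have "ostrowski_int \<theta> (l + 1) (q (l + 1) - m) \<beta>"
      unfolding ostrowski_int_def using m b1 a_ge_1[of 1] by simp
    then show ?thesis using m bt a_ge_1[of 1] by simp
  next
    assume "ostrowski_int \<theta> (l + 1) (q (l + 1) - m) \<beta>"
      "\<forall>j\<ge>1. \<beta> (l + 2 * j) = 0 \<and> \<beta> (l + 2 * j + 1) = a (l + 2 * j + 1)"
    then show ?thesis by simp
  qed
  then show "ostrowski_int \<theta> (l + 1) (q (l + 1) - m) \<beta>"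
    "j \<ge> 1 \<Longrightarrow> \<beta> (l + 2 * j) = 0" "j \<ge> 1 \<Longrightarrow> \<beta> (l + 2 * j + 1) = a (l + 2 * j + 1)" by blast+
qed

text \<open>The prefix has \<open>t (l + 1) = q (l + 1) - m\<close>, so its sum is
  \<open>- m * \<theta>\<close> plus \<open>cf_theta \<theta> (l + 1)\<close> up to an integer: the
  starting condition of \<open>alternating_tail\<close> with \<open>K = l + 1\<close>.\<close>

lemma neg_digits_beta:
  assumes nd: "neg_digits \<theta> m l \<beta> \<beta>'"
  shows "ostrowski_digits \<theta> \<beta>"
    "\<exists>C :: int. (\<Sum>j<l + 1. of_int (\<beta> (Suc j)) * cf_theta \<theta> j) = - of_int m * \<theta> + of_int C + cf_theta \<theta> (l + 1)"
proof -
  note f = neg_digits_beta_prefix_tail[OF nd]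
  have o: "q (l + 1) - m = (\<Sum>j=1..l+1. \<beta> j * q (j - 1))" "\<beta> 1 \<le> a 1 - 1"
    "\<And>j. 1 \<le> j \<Longrightarrow> j \<le> l + 1 \<Longrightarrow> 0 \<le> \<beta> j \<and> \<beta> j \<le> a j"
    "\<And>j. 1 \<le> j \<Longrightarrow> j < l + 1 \<Longrightarrow> \<beta> (j + 1) = a (j + 1) \<Longrightarrow> \<beta> j = 0"
    using f(1) unfolding ostrowski_int_def by auto
  have hi: "0 \<le> \<beta> k \<and> \<beta> k \<le> a k" if "k > l + 1" for k
    using that
  proof (cases rule: nat_above_cases)
    case (1 j)
    then show ?thesis using f(2)[of j] a_ge_1[of k] that by simp
  next
    case (2 j)
    then show ?thesis using f(3)[of j] a_ge_1[of k] that by simp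
  qed
  show od: "ostrowski_digits \<theta> \<beta>"
  proof unfold_locales
    show "\<beta> 1 \<le> a 1 - 1" by (rule o)
    fix k :: nat assume k: "k \<ge> 1"
    show "0 \<le> \<beta> k" "\<beta> k \<le> a k" using o(3)[of k] hi[of k] k by (cases "k \<le> l + 1"; auto)+
    assume full: "\<beta> (Suc k) = a (Suc k)"
    show "\<beta> k = 0"
    proof (cases "k < l + 1")
      case True
      then show ?thesis using o(4)[of k] k full by simp
    next
      case False
      then have "Suc k > l + 1" by simp
      then show ?thesis
      proof (cases rule: nat_above_cases)
        case (1 j)
        then show ?thesis using f(2)[of j] full a_ge_1[of "Suc k"] by simp
      next
        case (2 j)
        then show ?thesis using f(2)[of j] by simp
      qed
    qed
  qed
  interpret B: ostrowski_digits \<theta> \<beta> by (rule od)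
  have "B.t (l + 1) = q (l + 1) - m" using o(1) by (simp add: digit_t_def)
  then have "B.S (l + 1) = - of_int m * \<theta> + of_int (p (l + 1) - B.P (l + 1)) + cf_theta \<theta> (l + 1)"
    unfolding B.S_eq by (simp only: cf_theta_def of_int_diff) (simp add: algebra_simps)
  then show "\<exists>C :: int. (\<Sum>j<l + 1. of_int (\<beta> (Suc j)) * cf_theta \<theta> j) = - of_int m * \<theta> + of_int C + cf_theta \<theta> (l + 1)"
    unfolding B.S_def by blast
qed

text \<open>\<open>\<beta>'\<close> represents the same number as \<open>\<beta>\<close> modulo
  integers, but its alternating tail starts one level later, so the approach is from the other
  side.\<close>

lemma neg_digits_beta':
  assumes nd: "neg_digits \<theta> m l \<beta> \<beta>'"
  shows "ostrowski_digits \<theta> \<beta>'"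
    "\<exists>C :: int. (\<Sum>j<l + 2. of_int (\<beta>' (Suc j)) * cf_theta \<theta> j) = - of_int m * \<theta> + of_int C + cf_theta \<theta> (l + 2)"
    "\<beta>' (l + 2 + 2 * i + 1) = 0" "\<beta>' (l + 2 + 2 * i + 2) = a (l + 2 + 2 * i + 2)"
proof -
  interpret B: ostrowski_digits \<theta> \<beta> by (rule neg_digits_beta[OF nd])
  have "ostrowski_digits \<theta> \<beta>' \<and>
    (\<exists>C :: int. (\<Sum>j<l + 2. of_int (\<beta>' (Suc j)) * cf_theta \<theta> j) = - of_int m * \<theta> + of_int C + cf_theta \<theta> (l + 2)) \<and>
    \<beta>' (l + 2 + 2 * i + 1) = 0 \<and> \<beta>' (l + 2 + 2 * i + 2) = a (l + 2 + 2 * i + 2)"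
    using nd unfolding neg_digits_def
  proof (elim disjE conjE)
    assume m: "m = 1" "l = 0" and b1: "\<beta>' 1 = 0"
      and bt: "\<forall>j\<ge>1. \<beta>' (2 * j) = a (2 * j) \<and> \<beta>' (2 * j + 1) = 0"
    have odd0: "\<beta>' k = 0" if "odd k" for k
    proof -
      obtain j where "k = 2 * j + 1" using \<open>odd k\<close> by (rule oddE)
      then show ?thesis using b1 bt by (cases "j = 0") auto
    qed
    have eva: "\<beta>' k = a k" if "even k" "k \<ge> 1" for k
      using that bt by (auto elim!: evenE)
    have "ostrowski_digits \<theta> \<beta>'"
    proof unfold_locales
      show "\<beta>' 1 \<le> a 1 - 1" using b1 a_ge_1[of 1] by simp
      fix k :: nat assume k: "k \<ge> 1"
      show "0 \<le> \<beta>' k" "\<beta>' k \<le> a k" using odd0[of k] eva[of k] k a_ge_1[of k] by (cases "even k"; simp)+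
      assume "\<beta>' (Suc k) = a (Suc k)"
      then have "even (Suc k)" using odd0[of "Suc k"] a_ge_1[of "Suc k"] by fastforce
      then show "\<beta>' k = 0" using odd0[of k] by simp
    qed
    moreover have "(\<Sum>j<l + 2. of_int (\<beta>' (Suc j)) * cf_theta \<theta> j) = - of_int m * \<theta> + of_int 0 + cf_theta \<theta> (l + 2)"
    proof -
      have "{..<l + 2} = {0, 1}" using m by auto
      moreover have "cf_theta \<theta> 0 = \<theta>" by (simp add: cf_theta_def)
      ultimately show ?thesis
        using b1 eva[of 2] m cf_theta_Suc_Suc[of 0] by (simp add: numeral_2_eq_2)
    qed
    moreover have "\<beta>' (l + 2 + 2 * i + 1) = 0" by (rule odd0) (simp add: m)
    moreover have "\<beta>' (l + 2 + 2 * i + 2) = a (l + 2 + 2 * i + 2)" by (rule eva) (simp_all add: m)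
    ultimately show ?thesis by blast
  next
    assume m: "m \<ge> 2" "q l < m" "m \<le> q (l + 1)"
      and oi: "ostrowski_int \<theta> (l + 1) (q (l + 1) - m) \<beta>"
      and eq: "\<forall>i\<in>{1..l}. \<beta>' i = \<beta> i" and b1: "\<beta>' (l + 1) = \<beta> (l + 1) + 1"
      and b2: "\<beta>' (l + 2) = a (l + 2) - 1"
      and bt: "\<forall>j\<ge>1. \<beta>' (l + 2 * j + 1) = 0 \<and> \<beta>' (l + 2 * j + 2) = a (l + 2 * j + 2)"
    have t: "B.t (l + 1) = q (l + 1) - m" using oi by (simp add: digit_t_def ostrowski_int_def)
    have tl: "B.t l + \<beta> (l + 1) * q l < q (l + 1) - q l" using t m by (simp add: B.t_Suc)
    \<comment> \<open>\<open>q l < m\<close> forces the prefix sum below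
      \<open>q (l + 1) - q l\<close>, leaving room to raise the digit by one.\<close>
    have le: "\<beta> (l + 1) + 1 \<le> a (l + 1)"
    proof (rule ccontr)
      assume "\<not> ?thesis"
      then have "a (l + 1) \<le> \<beta> (l + 1)" by simp
      then have "a (l + 1) * q l \<le> \<beta> (l + 1) * q l" using q_pos[of l] by (intro mult_right_mono) auto
      moreover have "q (l + 1) - q l \<le> a (l + 1) * q l"
        using q_mono_Suc[of "l - 1"] q_Suc_Suc[of "l - 1"] by (cases l) auto
      ultimately show False using tl B.t_nonneg[of l] by simp
    qed
    \<comment> \<open>If the raised digit is full, the same estimate leaves less than
      \<open>q (l - 1)\<close> for the lower digits.\<close>
    have z: "\<beta> l = 0" if z1: "\<beta> (l + 1) + 1 = a (l + 1)" and z2: "l \<ge> 1"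
    proof -
      obtain n where n: "l = Suc n" using z2 by (cases l) auto
      have "\<beta> (l + 1) = a (l + 1) - 1" using z1 by simp
      then have "\<beta> (l + 1) * q l = a (l + 1) * q l - q l" by (simp only: left_diff_distrib mult_1)
      then have "B.t l < q n" using tl n by (simp add: q_Suc_Suc)
      then have "\<beta> (Suc n) * q n < 1 * q n" using B.t_nonneg[of n] n by (simp add: B.t_Suc)
      then have "\<beta> (Suc n) < 1" using q_pos[of n] by (simp only: mult_less_cancel_right)
      then show ?thesis using B.d_nonneg[of "Suc n"] n by simp
    qed
    have one: "\<beta>' 1 \<le> a 1 - 1"
    proof (cases "l = 0")
      case True
      then show ?thesis using b1 t m by (simp add: B.t_Suc B.t_0)
    next
      case False
      then show ?thesis using eq B.d_1 by simp
    qed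
    have hi: "\<beta>' k = a k \<or> \<beta>' k = 0" if k: "k > l + 2" for k
    proof -
      have "k > (l + 1) + 1" using k by simp
      then show ?thesis
      proof (cases rule: nat_above_cases)
        case (1 j)
        then show ?thesis using bt by (metis add.assoc add.commute)
      next
        case (2 j)
        then show ?thesis using bt by (simp add: algebra_simps)
      qed
    qed
    have "ostrowski_digits \<theta> \<beta>'"
    proof unfold_locales
      show "\<beta>' 1 \<le> a 1 - 1" by (rule one)
      fix k :: nat assume k: "k \<ge> 1"
      consider "k \<le> l" | "k = l + 1" | "k = l + 2" | "k > l + 2" by linarith
      then have "0 \<le> \<beta>' k \<and> \<beta>' k \<le> a k"
      proof cases
        case 1
        then show ?thesis using eq k B.d_nonneg[of k] B.d_le[of k] by simp
      next
        case 2
        then show ?thesis using b1 le B.d_nonneg[of k] by simp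
      next
        case 3
        then show ?thesis using b2 a_ge_1[of k] by simp
      next
        case 4
        then show ?thesis using hi[of k] a_ge_1[of k] by auto
      qed
      then show "0 \<le> \<beta>' k" "\<beta>' k \<le> a k" by auto
      assume full: "\<beta>' (Suc k) = a (Suc k)"
      consider "Suc k \<le> l" | "Suc k = l + 1" | "Suc k = l + 2" | "Suc k > (l + 1) + 1" by linarith
      then show "\<beta>' k = 0"
      proof cases
        case 1
        then show ?thesis using eq k B.d_rule[of k] full by simp
      next
        case 2
        then show ?thesis using eq k z b1 full by simp
      next
        case 3
        then show ?thesis using b2 full by simp
      next
        case 4
        then show ?thesis
        proof (cases rule: nat_above_cases)
          case (1 j)
          then have "\<beta>' (Suc k) = 0" using bt by (simp add: algebra_simps)
          then show ?thesis using full a_ge_1[of "Suc k"] by simp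
        next
          case (2 j)
          then show ?thesis using bt by (simp add: algebra_simps)
        qed
      qed
    qed
    moreover obtain C :: int where C: "B.S (l + 1) = - of_int m * \<theta> + of_int C + cf_theta \<theta> (l + 1)"
      using neg_digits_beta(2)[OF nd] unfolding B.S_def by blast
    \<comment> \<open>The change of digits adds \<open>cf_theta \<theta> l\<close> and
      \<open>a (l + 2) - 1\<close> times \<open>cf_theta \<theta> (l + 1)\<close>; the recurrence
      turns the deviation at level \<open>l + 1\<close> into the one at
      \<open>l + 2\<close>.\<close>
    moreover have "(\<Sum>j<l + 2. of_int (\<beta>' (Suc j)) * cf_theta \<theta> j) = - of_int m * \<theta> + of_int C + cf_theta \<theta> (l + 2)"
    proof -
      have "(\<Sum>j<l. of_int (\<beta>' (Suc j)) * cf_theta \<theta> j) = B.S l"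
        unfolding B.S_def using eq by (intro sum.cong) auto
      then have "(\<Sum>j<l + 2. of_int (\<beta>' (Suc j)) * cf_theta \<theta> j)
         = B.S l + (of_int (\<beta> (l + 1)) + 1) * cf_theta \<theta> l + (of_int (a (l + 2)) - 1) * cf_theta \<theta> (l + 1)"
        using b1 b2 by simp
      also have "\<dots> = B.S (l + 1) + cf_theta \<theta> (l + 2) - cf_theta \<theta> (l + 1)"
        using B.S_Suc[of l] cf_theta_Suc_Suc[of l] by (simp add: algebra_simps)
      finally show ?thesis using C by simp
    qed
    moreover have "\<beta>' (l + 2 + 2 * i + 1) = 0" "\<beta>' (l + 2 + 2 * i + 2) = a (l + 2 + 2 * i + 2)"
      using bt[rule_format, of "Suc i"] by (simp_all add: algebra_simps)
    ultimately show ?thesis by blast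
  qed
  then show "ostrowski_digits \<theta> \<beta>'"
    "\<exists>C :: int. (\<Sum>j<l + 2. of_int (\<beta>' (Suc j)) * cf_theta \<theta> j) = - of_int m * \<theta> + of_int C + cf_theta \<theta> (l + 2)"
    "\<beta>' (l + 2 + 2 * i + 1) = 0" "\<beta>' (l + 2 + 2 * i + 2) = a (l + 2 + 2 * i + 2)" by blast+
qed

text \<open>Brings both cases of the definition into the form needed by
  \<open>xi_lower_exponent\<close> and \<open>xi_upper_exponent\<close>: no orbit point is an
  integer, or the partial sums approach from the right side.\<close>

lemma attached_digits_cases:
  assumes "attached_digits upper \<theta> \<rho> d"
  shows "ostrowski_digits \<theta> d \<and> (\<exists>L C. L = \<rho> - \<theta> + of_int C \<and> ostrowski_digits.S \<theta> d \<longlonglongrightarrow> L \<and>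
    ((\<forall>m\<ge>1. real m * \<theta> + L \<notin> \<int>) \<or>
     (if upper then (\<forall>\<^sub>F J in sequentially. ostrowski_digits.S \<theta> d J < L)
      else (\<forall>\<^sub>F J in sequentially. L \<le> ostrowski_digits.S \<theta> d J))))"
proof (cases "(\<nexists>i j :: int. \<rho> = of_int i * \<theta> + of_int j) \<or>
         (\<exists>i j :: int. i \<ge> 1 \<and> \<rho> = of_int i * \<theta> + of_int j)")
  case True
  then have o: "ostrowski_real \<theta> (\<rho> - \<theta>) d" using assms unfolding attached_digits_def by simp
  have od: "ostrowski_digits \<theta> d"
    by unfold_locales (use o in \<open>auto simp: ostrowski_real_def\<close>)
  interpret D: ostrowski_digits \<theta> d by (rule od)
  have "D.S \<longlonglongrightarrow> \<rho> - \<theta>" using o unfolding ostrowski_real_def sums_def D.S_def[abs_def] by blast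
  moreover have "real m * \<theta> + (\<rho> - \<theta>) \<notin> \<int>" if "m \<ge> 1" for m
  proof
    assume "real m * \<theta> + (\<rho> - \<theta>) \<in> \<int>"
    then obtain z where z: "real m * \<theta> + (\<rho> - \<theta>) = of_int z" by (auto elim: Ints_cases)
    \<comment> \<open>The coefficient \<open>1 - m\<close> is not positive, while the case
      assumption then provides one with \<open>i \<ge> 1\<close>; irrationality of
      \<open>\<theta>\<close> forbids both.\<close>
    then have "\<rho> = of_int (1 - int m) * \<theta> + of_int z" by (simp add: algebra_simps)
    then obtain i j :: int where ij: "i \<ge> 1" "\<rho> = of_int i * \<theta> + of_int j" using True by blast
    have "of_int (int m + i - 1) * \<theta> = of_int (z - j)" using z ij(2) by (simp add: algebra_simps)
    then have "int m + i - 1 = 0" by (rule int_mult_theta_eq)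
    then show False using ij that by simp
  qed
  ultimately show ?thesis using od by (intro conjI exI[of _ "\<rho> - \<theta>"] exI[of _ 0]) auto
next
  case False
  then obtain m p0 l \<beta> \<beta>' where m: "\<rho> - \<theta> = - of_int m * \<theta> + of_int p0"
      and nd: "neg_digits \<theta> m l \<beta> \<beta>'"
      and d: "d = (if upper then (if odd l then \<beta>' else \<beta>) else (if odd l then \<beta> else \<beta>'))"
    using assms unfolding attached_digits_def if_not_P[OF False] by blast
  \<comment> \<open>\<open>K\<close> is \<open>l + 2\<close> for \<open>\<beta>'\<close> and
    \<open>l + 1\<close> for \<open>\<beta>\<close>. The selection by parity of \<open>l\<close>
    makes \<open>K\<close> odd exactly in the ceiling version, where approach from below is
    required.\<close>
  have "\<exists>K. odd K = upper \<and> ostrowski_digits \<theta> d \<and>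
    (\<exists>C :: int. (\<Sum>j<K. of_int (d (Suc j)) * cf_theta \<theta> j) = - of_int m * \<theta> + of_int C + cf_theta \<theta> K) \<and>
    (\<forall>i. d (K + 2 * i + 1) = 0 \<and> d (K + 2 * i + 2) = a (K + 2 * i + 2))"
  proof (cases "odd l = upper")
    case True
    then have "d = \<beta>'" using d by auto
    then show ?thesis using neg_digits_beta'[OF nd] True by (intro exI[of _ "l + 2"]) simp
  next
    case False
    then have "d = \<beta>" using d by auto
    moreover have "\<beta> (l + 1 + 2 * i + 1) = 0" "\<beta> (l + 1 + 2 * i + 2) = a (l + 1 + 2 * i + 2)" for i
      using neg_digits_beta_prefix_tail(2,3)[OF nd, of "Suc i"] by simp_all
    ultimately show ?thesis using neg_digits_beta[OF nd] False by (intro exI[of _ "l + 1"]) simp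
  qed
  then obtain K C where K: "odd K = upper" and od: "ostrowski_digits \<theta> d"
    and S: "(\<Sum>j<K. of_int (d (Suc j)) * cf_theta \<theta> j) = - of_int m * \<theta> + of_int C + cf_theta \<theta> K"
    and tail: "\<And>i. d (K + 2 * i + 1) = 0" "\<And>i. d (K + 2 * i + 2) = a (K + 2 * i + 2)"
    by blast
  interpret D: ostrowski_digits \<theta> d by (rule od)
  define L where "L = - of_int m * \<theta> + of_int C"
  have "D.S K = L + cf_theta \<theta> K" using S by (simp add: D.S_def L_def)
  note at = D.alternating_tail[OF this tail]
  have "L = \<rho> - \<theta> + of_int (C - p0)" by (simp add: L_def m)
  then show ?thesis using od at K by (intro conjI exI[of _ L] exI[of _ "C - p0"]) auto
qed

end

theorem theorem2p4:
  fixes b :: int and \<theta> \<rho> \<xi> :: real and d :: "nat \<Rightarrow> int"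
  assumes "b \<ge> 2"
    and "0 < \<theta>" "\<theta> < 1" "\<theta> \<notin> \<rat>"
    and "0 \<le> \<rho>" "\<rho> < 1"
    and "\<xi> = xi_lower b \<theta> \<rho> \<and> attached_digits False \<theta> \<rho> d \<or>
         \<xi> = xi_upper b \<theta> \<rho> \<and> attached_digits True \<theta> \<rho> d"
  shows "irrationality_exponent \<xi> = Max {nu1 \<theta> d, nu2 \<theta> d, nu3 \<theta> d, nu4 \<theta> d}"
proof -
  interpret irrational_cf \<theta> using assms by unfold_locales
  from assms(7) show ?thesis
  proof (elim disjE conjE)
    assume xi: "\<xi> = xi_lower b \<theta> \<rho>" and "attached_digits False \<theta> \<rho> d"
    note A = attached_digits_cases[OF this(2)]
    interpret ostrowski_digits \<theta> d using A by blast
    from A obtain L C where "L = \<rho> - \<theta> + of_int C" "S \<longlonglongrightarrow> L"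
      "(\<forall>m\<ge>1. real m * \<theta> + L \<notin> \<int>) \<or> (\<forall>\<^sub>F J in sequentially. L \<le> S J)" by auto
    then show ?thesis unfolding xi using assms(1) by (intro xi_lower_exponent) auto
  next
    assume xi: "\<xi> = xi_upper b \<theta> \<rho>" and "attached_digits True \<theta> \<rho> d"
    note A = attached_digits_cases[OF this(2)]
    interpret ostrowski_digits \<theta> d using A by blast
    from A obtain L C where "L = \<rho> - \<theta> + of_int C" "S \<longlonglongrightarrow> L"
      "(\<forall>m\<ge>1. real m * \<theta> + L \<notin> \<int>) \<or> (\<forall>\<^sub>F J in sequentially. S J < L)" by auto
    then show ?thesis unfolding xi using assms(1) by (intro xi_upper_exponent) auto
  qed
qed

end
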